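(* Let $t\ge 2$, let $G_1$ and $G_2$ be two non-cospectral connected cubic graphs on $2t$ vertices, and let $G$ be any connected $r$-regular graph with $r\ge 2$. Let $H_1=L^2(G_1)$ and $H_2=L^2(G_2)$. Then: 1. $G\,\dot\vee\,H_1$ and $G\,\dot\vee\,H_2$ are non $\epsilon$-cospectral $\epsilon$-equienergetic graphs; 2. $G\veebar H_1$ and $G\veebar H_2$ are non $\epsilon$-cospectral $\epsilon$-equienergetic graphs; 3. $G\,\dot\vee\,(H_1\cup H_2)$, $G\,\dot\vee\,(H_1\cup H_1)$ and $G\,\dot\vee\,(H_2\cup H_2)$ are (pairwise) non $\epsilon$-cospectral $\epsilon$-equienergetic graphs; 4. $G\veebar(H_1\cup H_2)$, $G\veebar(H_1\cup H_1)$ and $G\veebar(H_2\cup H_2)$ are (pairwise) non $\epsilon$-cospectral $\epsilon$-equienergetic graphs.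
   Context: All graphs are finite, simple and undirected. A cubic graph is a $3$-regular graph. The line graph $L(G)$ has vertex set $E(G)$, two vertices being adjacent iff the corresponding edges share an end vertex; $L^2(G)=L(L(G))$. $G\cup H$ denotes disjoint union (of disjoint copies). Two graphs of the same order are cospectral if they have the same adjacency spectrum with multiplicities, and non-cospectral otherwise. The subdivision graph $S(G)$ is obtained from $G$ by subdividing each edge with one new vertex; $I(G)$ is the set of these new vertices, so $V(S(G))=V(G)\cup I(G)$. For vertex-disjoint graphs $G,H$: the subdivision-vertex join $G\,\dot\vee\,H$ is obtained from $S(G)$ and $H$ by joining each vertex of $V(G)$ to every vertex of $V(H)$; the subdivision-edge join $G\veebar H$ is obtained from $S(G)$ and $H$ by joining each vertex of $I(G)$ to every vertex of $V(H)$. For a connected graph $G$ with distance function $d$, the eccentricity of a vertex $v$ is $e(v)=\max\{d(v,u):u\in V(G)\}$. The eccentricity matrix $\epsilon(G)$ is the symmetric matrix indexed by $V(G)$ with $(u,v)$ entry $d(u,v)$ if $d(u,v)=\min\{e(u),e(v)\}$, and $0$ otherwise. The $\epsilon$-spectrum of $G$ is the multiset of eigenvalues of $\epsilon(G)$, and the $\epsilon$-energy is the sum of the absolute values of these eigenvalues (with multiplicity). Two non-isomorphic graphs of the same order are $\epsilon$-cospectral if they have the same $\epsilon$-spectrum, and non $\epsilon$-cospectral otherwise. Two graphs of the same order are $\epsilon$-equienergetic if they have the same $\epsilon$-energy. *)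

theory Defs
  imports
    "Graph_Theory.Pair_Digraph"
    "Graph_Theory.Digraph_Component"
    "Graph_Theory.Digraph_Isomorphism"
    "Jordan_Normal_Form.Char_Poly"
begin

text \<open>
  Finite simple undirected graphs are the \<^locale>\<open>pair_graph\<close>s: finite, loop-free, and with a
  symmetric arc relation, so that the undirected edge \<open>{u, v}\<close> is the pair of arcs \<open>(u, v)\<close>, \<open>(v, u)\<close>.
  The out-degree is then the usual degree.
\<close>

abbreviation order_of :: "'a pair_pre_digraph \<Rightarrow> nat" where
  "order_of G \<equiv> card (pverts G)"

definition regular_graph :: "'a pair_pre_digraph \<Rightarrow> nat \<Rightarrow> bool" where
  "regular_graph G r \<longleftrightarrow> (\<forall>v \<in> pverts G. out_degree G v = r)"

definition edges :: "'a pair_pre_digraph \<Rightarrow> 'a set set" where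
  "edges G = {{u, v} | u v. (u, v) \<in> parcs G}"

definition line_graph :: "'a pair_pre_digraph \<Rightarrow> 'a set pair_pre_digraph" where
  "line_graph G = \<lparr> pverts = edges G,
     parcs = {(e, f). e \<in> edges G \<and> f \<in> edges G \<and> e \<noteq> f \<and> e \<inter> f \<noteq> {}} \<rparr>"

definition disjoint_union_graph ::
  "'a pair_pre_digraph \<Rightarrow> 'b pair_pre_digraph \<Rightarrow> ('a + 'b) pair_pre_digraph" where
  "disjoint_union_graph G H = \<lparr> pverts = pverts G <+> pverts H,
     parcs = {(Inl u, Inl v) | u v. (u, v) \<in> parcs G} \<union> {(Inr u, Inr v) | u v. (u, v) \<in> parcs H} \<rparr>"

text \<open>In \<open>S(G)\<close>, \<open>Inl v\<close> is an original vertex and \<open>Inr e\<close> is the vertex subdividing the edge \<open>e\<close>.\<close>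

definition subdivision_graph :: "'a pair_pre_digraph \<Rightarrow> ('a + 'a set) pair_pre_digraph" where
  "subdivision_graph G = \<lparr> pverts = pverts G <+> edges G,
     parcs = {(Inl v, Inr e) | v e. e \<in> edges G \<and> v \<in> e} \<union>
             {(Inr e, Inl v) | v e. e \<in> edges G \<and> v \<in> e} \<rparr>"

text \<open>
  \<open>join_along A G H\<close> is the disjoint union of \<open>G\<close> and \<open>H\<close> in which, in addition, every vertex of
  \<open>A \<subseteq> V(G)\<close> is joined to every vertex of \<open>H\<close>.
\<close>

definition join_along ::
  "'a set \<Rightarrow> 'a pair_pre_digraph \<Rightarrow> 'b pair_pre_digraph \<Rightarrow> ('a + 'b) pair_pre_digraph" where
  "join_along A G H = \<lparr> pverts = pverts (disjoint_union_graph G H),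
     parcs = parcs (disjoint_union_graph G H) \<union>
       {(Inl a, Inr h) | a h. a \<in> A \<and> h \<in> pverts H} \<union> {(Inr h, Inl a) | a h. a \<in> A \<and> h \<in> pverts H} \<rparr>"

definition subdivision_vertex_join ::
  "'a pair_pre_digraph \<Rightarrow> 'b pair_pre_digraph \<Rightarrow> (('a + 'a set) + 'b) pair_pre_digraph" where
  "subdivision_vertex_join G H = join_along (Inl ` pverts G) (subdivision_graph G) H"

definition subdivision_edge_join ::
  "'a pair_pre_digraph \<Rightarrow> 'b pair_pre_digraph \<Rightarrow> (('a + 'a set) + 'b) pair_pre_digraph" where
  "subdivision_edge_join G H = join_along (Inr ` edges G) (subdivision_graph G) H"

text \<open>The length of a shortest walk; meaningful only if \<open>v\<close> is reachable from \<open>u\<close>.\<close>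

definition distance :: "'a pair_pre_digraph \<Rightarrow> 'a \<Rightarrow> 'a \<Rightarrow> nat" where
  "distance G u v = (LEAST n. \<exists>p. pre_digraph.awalk G u p v \<and> length p = n)"

definition eccentricity :: "'a pair_pre_digraph \<Rightarrow> 'a \<Rightarrow> nat" where
  "eccentricity G v = Max (distance G v ` pverts G)"

definition adjacency_entry :: "'a pair_pre_digraph \<Rightarrow> 'a \<Rightarrow> 'a \<Rightarrow> nat" where
  "adjacency_entry G u v = (if (u, v) \<in> parcs G then 1 else 0)"

definition ecc_entry :: "'a pair_pre_digraph \<Rightarrow> 'a \<Rightarrow> 'a \<Rightarrow> nat" where
  "ecc_entry G u v =
     (if distance G u v = min (eccentricity G u) (eccentricity G v) then distance G u v else 0)"

text \<open>
  A matrix indexed by a finite vertex set is turned into a \<^typ>\<open>complex mat\<close> by listing the vertices.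
  Working over the complex numbers guarantees that all eigenvalues are present, with multiplicity, as
  roots of the characteristic polynomial; lemma \<open>spectrum_on_eq\<close> shows that the chosen listing of the
  vertices does not matter.
\<close>

definition matrix_of :: "'a list \<Rightarrow> ('a \<Rightarrow> 'a \<Rightarrow> nat) \<Rightarrow> complex mat" where
  "matrix_of vs m = mat (length vs) (length vs) (\<lambda>(i, j). of_nat (m (vs ! i) (vs ! j)))"

definition spectrum_on :: "'a set \<Rightarrow> ('a \<Rightarrow> 'a \<Rightarrow> nat) \<Rightarrow> complex multiset" where
  "spectrum_on V m = proots (char_poly (matrix_of (SOME vs. distinct vs \<and> set vs = V) m))"

lemma char_poly_matrix_of_perm:
  assumes "distinct vs" "distinct ws" "set vs = set ws"
  shows "char_poly (matrix_of vs m) = char_poly (matrix_of ws m)"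
proof -
  define n where "n = length vs"
  have lw: "length ws = n"
    using assms by (metis n_def distinct_card)
  have mset_eq: "mset ws = mset vs"
    using assms set_eq_iff_mset_eq_distinct by metis
  obtain p where p: "p permutes {..<length vs}" "permute_list p vs = ws"
    using mset_eq_permutation[OF mset_eq] by blast
  have pn: "p permutes {0..<n}" using p(1) by (simp add: n_def atLeast0LessThan)
  have pl: "p i < n" if "i < n" for i
    using permutes_in_image[OF pn, of i] that by simp
  have nth: "ws ! i = vs ! p i" if "i < n" for i
    using p that by (metis n_def permute_list_nth)
  define X where "X = char_poly_matrix (matrix_of vs m)"
  define Y where "Y = char_poly_matrix (matrix_of ws m)"
  have Xc: "X \<in> carrier_mat n n" and Yc: "Y \<in> carrier_mat n n"
    by (auto simp: X_def Y_def char_poly_matrix_def matrix_of_def n_def lw)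
  have inj: "p i = p j \<longleftrightarrow> i = j" for i j
    using permutes_inj[OF pn] by (auto dest: injD)
  have Y: "Y $$ (i, j) = X $$ (p i, p j)" if "i < n" "j < n" for i j
    using that pl nth inj
    by (auto simp: X_def Y_def char_poly_matrix_def matrix_of_def lw n_def[symmetric])
  define Z where "Z = mat n n (\<lambda>(i, j). X $$ (p i, j))"
  have Zc: "Z \<in> carrier_mat n n" by (simp add: Z_def)
  have "Y = transpose_mat (mat n n (\<lambda>(i, j). transpose_mat Z $$ (p i, j)))"
    by (rule eq_matI) (use Yc pl in \<open>auto simp: Y Z_def\<close>)
  then have "det Y = det (mat n n (\<lambda>(i, j). transpose_mat Z $$ (p i, j)))"
    by (metis det_transpose mat_carrier)
  also have "\<dots> = signof p * det (transpose_mat Z)"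
    by (rule det_permute_rows[OF _ pn]) (simp add: Zc)
  also have "det (transpose_mat Z) = det Z" by (rule det_transpose[OF Zc])
  also have "det Z = signof p * det X"
    unfolding Z_def by (rule det_permute_rows[OF Xc pn])
  finally have "det Y = det X"
    by (auto simp: sign_def split: if_splits)
  then show ?thesis by (simp add: char_poly_def X_def Y_def)
qed

lemma spectrum_on_eq:
  assumes "distinct vs" "set vs = V"
  shows "spectrum_on V m = proots (char_poly (matrix_of vs m))"
proof -
  have "distinct (SOME vs. distinct vs \<and> set vs = V) \<and> set (SOME vs. distinct vs \<and> set vs = V) = V"
    by (rule someI[of _ vs]) (use assms in simp)
  then show ?thesis
    unfolding spectrum_on_def using char_poly_matrix_of_perm assms by metis
qed

definition adjacency_spectrum :: "'a pair_pre_digraph \<Rightarrow> complex multiset" where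
  "adjacency_spectrum G = spectrum_on (pverts G) (adjacency_entry G)"

definition ecc_spectrum :: "'a pair_pre_digraph \<Rightarrow> complex multiset" where
  "ecc_spectrum G = spectrum_on (pverts G) (ecc_entry G)"

definition ecc_energy :: "'a pair_pre_digraph \<Rightarrow> real" where
  "ecc_energy G = (\<Sum>x \<in># ecc_spectrum G. cmod x)"

definition non_cospectral :: "'a pair_pre_digraph \<Rightarrow> 'b pair_pre_digraph \<Rightarrow> bool" where
  "non_cospectral G H \<longleftrightarrow> order_of G = order_of H \<and> adjacency_spectrum G \<noteq> adjacency_spectrum H"

definition non_ecc_cospectral :: "'a pair_pre_digraph \<Rightarrow> 'b pair_pre_digraph \<Rightarrow> bool" where
  "non_ecc_cospectral G H \<longleftrightarrow> order_of G = order_of H \<and> \<not> digraph_iso (with_proj G) (with_proj H) \<and>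
     ecc_spectrum G \<noteq> ecc_spectrum H"

definition ecc_equienergetic :: "'a pair_pre_digraph \<Rightarrow> 'b pair_pre_digraph \<Rightarrow> bool" where
  "ecc_equienergetic G H \<longleftrightarrow> order_of G = order_of H \<and> ecc_energy G = ecc_energy H"

end

theory Submission
  imports Defs "Jordan_Normal_Form.Schur_Decomposition"
begin

text \<open>
  When \<open>H\<close> is joined to one colour class \<open>X\<close> of a bipartite graph \<open>S\<close>, no distance exceeds 4 and the
  eccentricity matrix is \<open>[[M, w 1\<^sup>T], [1 w\<^sup>T, 2(J - I - A(H))]]\<close>, where \<open>M\<close> and \<open>w\<close> do not depend on \<open>H\<close>.
  Both subdivision joins have this form. For \<open>k\<close>-regular \<open>H\<close> the all-ones vector is an eigenvector of
  \<open>C = - 2 I - 2 A(H)\<close>, so \<open>x I\<close> minus the eccentricity matrix factors as \<open>diag(I, x I - C)\<close> times a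
  matrix that depends on \<open>H\<close> only through \<open>k\<close> and the order of \<open>H\<close>. Hence the \<open>\<epsilon>\<close>-spectrum of the join,
  minus the multiset of the \<open>- 2 - 2 \<lambda>\<close> with \<open>\<lambda>\<close> an adjacency eigenvalue of \<open>H\<close>, is the same for all such \<open>H\<close>.

  With the vertex-edge incidence matrix \<open>B\<close>, \<open>B B\<^sup>T = A(G) + r I\<close> and \<open>B\<^sup>T B = A(L(G)) + 2 I\<close> for
  \<open>r\<close>-regular \<open>G\<close>. So for cubic \<open>G\<close> on \<open>2 t\<close> vertices, \<open>L\<^sup>2(G)\<close> is 6-regular with eigenvalues
  \<open>\<lambda> + 3 \<ge> 0\<close>, \<open>0\<close> (\<open>t\<close> times) and \<open>- 2\<close> (\<open>3 t\<close> times). This spectrum determines that of \<open>G\<close>, but the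
  sum of the \<open>\<bar>2 + 2 \<lambda>\<bar>\<close> depends on \<open>t\<close> only, because all \<open>\<lambda> + 3\<close> are nonnegative and the trace of \<open>A(G)\<close> is 0.
\<close>

section \<open>Characteristic polynomials\<close>

text \<open>A nonzero difference would have finitely many roots, so the infinite domain would be a
  union of two finite sets. This allows determinants to be compared pointwise, and a point such as
  \<open>x = c\<close> to be left out when \<open>x - c\<close> has to be inverted.\<close>

lemma poly_eqI_cofinite:
  fixes p q :: "'a :: {idom, ring_char_0} poly"
  assumes "finite S" and "\<And>x. x \<notin> S \<Longrightarrow> poly p x = poly q x"
  shows "p = q"
proof (rule ccontr)
  assume "p \<noteq> q"
  then have "finite {x. poly (p - q) x = 0}"
    by (intro poly_roots_finite) simp
  moreover have "UNIV = {x. poly (p - q) x = 0} \<union> S"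
    using assms(2) by auto
  ultimately have "finite (UNIV :: 'a set)"
    using assms(1) by (metis finite_UnI)
  then show False
    using infinite_UNIV_char_0 by blast
qed

lemma poly_char_poly:
  fixes A :: "'a :: field mat"
  assumes "A \<in> carrier_mat n n"
  shows "poly (char_poly A) x = det (x \<cdot>\<^sub>m 1\<^sub>m n - A)"
proof -
  have "- char_matrix A x = x \<cdot>\<^sub>m 1\<^sub>m n - A"
    using assms by (intro eq_matI) (auto simp: char_matrix_def)
  then show ?thesis
    using char_poly_matrix[OF assms] by simp
qed

lemma char_poly_neq_0:
  fixes A :: "'a :: comm_ring_1 mat"
  assumes "A \<in> carrier_mat n n"
  shows "char_poly A \<noteq> 0"
  using degree_monic_char_poly[OF assms] by (metis coeff_0 zero_neq_one)

text \<open>Two triangularisations of the same block matrix \<open>?M\<close>. Multiplying by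
  \<open>?R\<close> on the right clears the lower left block and gives
  \<open>det ?M = det (x I - A B)\<close>, as \<open>det ?R = 1\<close>. Multiplying by
  \<open>?L\<close> on the left clears it too and gives
  \<open>x ^ m * det ?M = x ^ n * det (x I - B A)\<close>. The monomials account for the differing
  numbers of zero eigenvalues.\<close>

lemma char_poly_mult_commute:
  fixes A B :: "'a :: {field, ring_char_0} mat"
  assumes A: "A \<in> carrier_mat n m" and B: "B \<in> carrier_mat m n"
  shows "monom 1 m * char_poly (A * B) = monom 1 n * char_poly (B * A)"
proof (rule poly_eqI_cofinite[of "{}"])
  fix x :: 'a
  let ?M = "four_block_mat (x \<cdot>\<^sub>m 1\<^sub>m n) A B (1\<^sub>m m)"
  let ?R = "four_block_mat (1\<^sub>m n) (0\<^sub>m n m) (- B) (1\<^sub>m m)"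
  let ?L = "four_block_mat (1\<^sub>m n) (0\<^sub>m n m) (- B) (x \<cdot>\<^sub>m 1\<^sub>m m)"
  have AB: "A * B \<in> carrier_mat n n" and BA: "B * A \<in> carrier_mat m m"
    using A B by auto
  have M: "?M \<in> carrier_mat (n + m) (n + m)" and R: "?R \<in> carrier_mat (n + m) (n + m)"
    and L: "?L \<in> carrier_mat (n + m) (n + m)"
    using A B by auto
  have mB: "- B \<in> carrier_mat m n" using B by simp
  have "?M * ?R = four_block_mat (x \<cdot>\<^sub>m 1\<^sub>m n * 1\<^sub>m n + A * - B) (x \<cdot>\<^sub>m 1\<^sub>m n * 0\<^sub>m n m + A * 1\<^sub>m m)
      (B * 1\<^sub>m n + 1\<^sub>m m * - B) (B * 0\<^sub>m n m + 1\<^sub>m m * 1\<^sub>m m)"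
    by (rule mult_four_block_mat) (use A B in auto)
  also have "\<dots> = four_block_mat (x \<cdot>\<^sub>m 1\<^sub>m n - A * B) A (0\<^sub>m m n) (1\<^sub>m m)"
  proof (intro cong_four_block_mat)
    show "x \<cdot>\<^sub>m 1\<^sub>m n * 1\<^sub>m n + A * - B = x \<cdot>\<^sub>m 1\<^sub>m n - A * B"
      using A B by (simp add: right_mult_one_mat[of _ n n]) (intro eq_matI; auto)
    show "B * 1\<^sub>m n + 1\<^sub>m m * - B = 0\<^sub>m m n"
      using B mB by simp (intro eq_matI; auto)
  qed (use A B in auto)
  finally have "det ?M * det ?R = det (four_block_mat (x \<cdot>\<^sub>m 1\<^sub>m n - A * B) A (0\<^sub>m m n) (1\<^sub>m m))"
    using det_mult[OF M R] by simp
  also have "\<dots> = det (x \<cdot>\<^sub>m 1\<^sub>m n - A * B)"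
    using det_four_block_mat_lower_left_zero[of "x \<cdot>\<^sub>m 1\<^sub>m n - A * B" n A m "0\<^sub>m m n" "1\<^sub>m m"] A B
    by (simp add: minus_carrier_mat)
  also have "det ?R = 1"
    using det_four_block_mat_upper_right_zero[of "1\<^sub>m n" n _ m "- B" "1\<^sub>m m"] B by auto
  finally have 1: "det ?M = poly (char_poly (A * B)) x"
    using poly_char_poly[OF AB] by simp
  have "?L * ?M = four_block_mat (1\<^sub>m n * (x \<cdot>\<^sub>m 1\<^sub>m n) + 0\<^sub>m n m * B) (1\<^sub>m n * A + 0\<^sub>m n m * 1\<^sub>m m)
      (- B * (x \<cdot>\<^sub>m 1\<^sub>m n) + x \<cdot>\<^sub>m 1\<^sub>m m * B) (- B * A + x \<cdot>\<^sub>m 1\<^sub>m m * 1\<^sub>m m)"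
    by (rule mult_four_block_mat) (use A B in auto)
  also have "\<dots> = four_block_mat (x \<cdot>\<^sub>m 1\<^sub>m n) A (0\<^sub>m m n) (x \<cdot>\<^sub>m 1\<^sub>m m - B * A)"
  proof (intro cong_four_block_mat)
    show "- B * (x \<cdot>\<^sub>m 1\<^sub>m n) + x \<cdot>\<^sub>m 1\<^sub>m m * B = 0\<^sub>m m n"
      using B by (simp add: mult_smult_distrib[of _ m n _ n] mult_smult_assoc_mat[of _ m m _ n]
          right_mult_one_mat[OF mB]) (intro eq_matI; auto)
    show "- B * A + x \<cdot>\<^sub>m 1\<^sub>m m * 1\<^sub>m m = x \<cdot>\<^sub>m 1\<^sub>m m - B * A"
      using A B by (simp add: right_mult_one_mat[of _ m m]) (intro eq_matI; auto)
  qed (use A B in auto)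
  finally have "det ?L * det ?M = det (four_block_mat (x \<cdot>\<^sub>m 1\<^sub>m n) A (0\<^sub>m m n) (x \<cdot>\<^sub>m 1\<^sub>m m - B * A))"
    using det_mult[OF L M] by simp
  also have "\<dots> = x ^ n * poly (char_poly (B * A)) x"
    using det_four_block_mat_lower_left_zero[of "x \<cdot>\<^sub>m 1\<^sub>m n" n A m "0\<^sub>m m n" "x \<cdot>\<^sub>m 1\<^sub>m m - B * A"] A B
    by (simp add: minus_carrier_mat poly_char_poly[OF BA])
  also have "det ?L = x ^ m"
    using det_four_block_mat_upper_right_zero[of "1\<^sub>m n" n _ m "- B" "x \<cdot>\<^sub>m 1\<^sub>m m"] B by auto
  finally show "poly (monom 1 m * char_poly (A * B)) x = poly (monom 1 n * char_poly (B * A)) x"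
    by (simp add: 1 poly_monom)
qed simp

section \<open>Eigenvalues as multisets of roots\<close>

lemma proots_monom: "proots (monom 1 n :: 'a :: idom poly) = replicate_mset n 0"
proof -
  have "(monom 1 n :: 'a poly) = [:0, 1:] ^ n"
    by (simp add: monom_altdef)
  then show ?thesis
    by (simp add: proots_power)
qed

lemma proots_prod_linear_factors:
  "proots (\<Prod>x\<leftarrow>xs. [:- f x, 1:]) = image_mset f (mset xs)"
proof (induction xs)
  case (Cons x xs)
  have "(\<Prod>x\<leftarrow>xs. [:- f x, 1:]) \<noteq> 0"
    by (auto simp: prod_list_zero_iff)
  then have "proots ([:- f x, 1:] * (\<Prod>x\<leftarrow>xs. [:- f x, 1:])) = add_mset (f x) (image_mset f (mset xs))"
    by (subst proots_mult) (use Cons in \<open>simp_all del: mult_pCons_left\<close>)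
  then show ?case by (simp del: mult_pCons_left)
qed simp

lemma proots_char_poly_affine:
  fixes A :: "complex mat"
  assumes A: "A \<in> carrier_mat n n"
  shows "proots (char_poly (c \<cdot>\<^sub>m A + d \<cdot>\<^sub>m 1\<^sub>m n)) = image_mset (\<lambda>x. c * x + d) (proots (char_poly A))"
proof -
  obtain es where es: "char_poly A = (\<Prod>a\<leftarrow>es. [:- a, 1:])"
    using char_poly_factorized[OF A] by blast
  have len: "length es = n" 
    using degree_monic_char_poly[OF A] degree_linear_factors[of uminus es] es by simp
  have "char_poly (c \<cdot>\<^sub>m A + d \<cdot>\<^sub>m 1\<^sub>m n) = (\<Prod>a\<leftarrow>es. [:- (c * a + d), 1:])"
  proof (rule poly_eqI_cofinite[of "{}"])
    fix x :: complex
    have C: "c \<cdot>\<^sub>m A + d \<cdot>\<^sub>m 1\<^sub>m n \<in> carrier_mat n n" using A by simp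
    have "det (x \<cdot>\<^sub>m 1\<^sub>m n - (c \<cdot>\<^sub>m A + d \<cdot>\<^sub>m 1\<^sub>m n)) = (\<Prod>a\<leftarrow>es. x - c * a - d)"
    \<comment> \<open>For \<open>c = 0\<close> the matrix is scalar and the product is a plain
      power. Otherwise \<open>c\<close> is pulled out of the determinant, which leaves the
      characteristic polynomial of \<open>A\<close> at \<open>(x - d) / c\<close>; the factor
      \<open>c ^ n\<close> is then spread over the \<open>n\<close> linear factors.\<close>
    proof (cases "c = 0")
      case True
      then have "x \<cdot>\<^sub>m 1\<^sub>m n - (c \<cdot>\<^sub>m A + d \<cdot>\<^sub>m 1\<^sub>m n) = (x - d) \<cdot>\<^sub>m 1\<^sub>m n"
        using A by (intro eq_matI) auto
      with True show ?thesis using len by (simp add: prod_list_replicate map_replicate_const)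
    next
      case False
      have "x \<cdot>\<^sub>m 1\<^sub>m n - (c \<cdot>\<^sub>m A + d \<cdot>\<^sub>m 1\<^sub>m n) = c \<cdot>\<^sub>m (((x - d) / c) \<cdot>\<^sub>m 1\<^sub>m n - A)"
        using A False by (intro eq_matI) (auto simp: field_simps)
      then have "det (x \<cdot>\<^sub>m 1\<^sub>m n - (c \<cdot>\<^sub>m A + d \<cdot>\<^sub>m 1\<^sub>m n)) = c ^ n * poly (char_poly A) ((x - d) / c)"
        using A by (simp add: poly_char_poly[OF A])
      also have "\<dots> = c ^ length es * (\<Prod>a\<leftarrow>es. (x - d) / c - a)"
        by (simp add: es len poly_prod_list o_def)
      also have "\<dots> = (\<Prod>a\<leftarrow>es. x - c * a - d)"
        using False by (induction es) (auto simp: field_simps)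
      finally show ?thesis .
    qed
    then show "poly (char_poly (c \<cdot>\<^sub>m A + d \<cdot>\<^sub>m 1\<^sub>m n)) x = poly (\<Prod>a\<leftarrow>es. [:- (c * a + d), 1:]) x"
      unfolding poly_char_poly[OF C] by (simp add: poly_prod_list o_def algebra_simps)
  qed simp
  then show ?thesis
    by (simp only: es proots_prod_linear_factors) (simp add: proots_prod_linear_factors[of "\<lambda>x. x"])
qed

text \<open>The columns of \<open>V\<close> and \<open>D\<close> are eigenvectors, or zero, for the
  eigenvalue \<open>c\<close> of both \<open>C1\<close> and \<open>C2\<close>. Hence
  \<open>x I - C\<close> acts on them as multiplication by \<open>x - c\<close>, and
  \<open>x I\<close> minus the block matrix is \<open>diag(I, x I - C)\<close> times a matrix
  without \<open>C\<close>. The cross-multiplied form avoids division by a characteristic polynomial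
  that may vanish at \<open>x\<close>.\<close>

lemma char_poly_four_block_exchange:
  fixes C1 C2 :: "'a :: {field, ring_char_0} mat"
  assumes M: "M \<in> carrier_mat n n" and U: "U \<in> carrier_mat n p" and V: "V \<in> carrier_mat p n"
    and D: "D \<in> carrier_mat p p" and C1: "C1 \<in> carrier_mat p p" and C2: "C2 \<in> carrier_mat p p"
    and "C1 * V = c \<cdot>\<^sub>m V" "C1 * D = c \<cdot>\<^sub>m D" "C2 * V = c \<cdot>\<^sub>m V" "C2 * D = c \<cdot>\<^sub>m D"
  shows "char_poly (four_block_mat M U V (C1 + D)) * char_poly C2 =
    char_poly (four_block_mat M U V (C2 + D)) * char_poly C1"
proof (rule poly_eqI_cofinite[of "{c}"])
  fix x :: 'a
  assume "x \<notin> {c}"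
  then have xc: "x - c \<noteq> 0" by simp
  \<comment> \<open>The cofactor common to \<open>C1\<close> and \<open>C2\<close>: dividing
    \<open>V\<close> and \<open>D\<close> by \<open>x - c\<close> anticipates the factor that
    \<open>x I - C\<close> puts back.\<close>
  define G where "G = four_block_mat (x \<cdot>\<^sub>m 1\<^sub>m n - M) (- U)
    ((- 1 / (x - c)) \<cdot>\<^sub>m V) (1\<^sub>m p - (1 / (x - c)) \<cdot>\<^sub>m D)"
  have factor: "poly (char_poly (four_block_mat M U V (C + D))) x = poly (char_poly C) x * det G"
    if C: "C \<in> carrier_mat p p" and CV: "C * V = c \<cdot>\<^sub>m V" and CD: "C * D = c \<cdot>\<^sub>m D" for C
  proof -
    let ?Z = "x \<cdot>\<^sub>m 1\<^sub>m p - C"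
    let ?E = "four_block_mat (1\<^sub>m n) (0\<^sub>m n p) (0\<^sub>m p n) ?Z"
    have Z: "?Z \<in> carrier_mat p p" using C by auto
    have ZV: "?Z * V = (x - c) \<cdot>\<^sub>m V"
    proof -
      have "?Z * V = x \<cdot>\<^sub>m V - C * V"
        using C V by (simp add: minus_mult_distrib_mat[of _ p p _ _ n] mult_smult_assoc_mat[of _ p p _ n])
      then show ?thesis unfolding CV using V by (intro eq_matI) (auto simp: algebra_simps)
    qed
    have ZD: "?Z * D = (x - c) \<cdot>\<^sub>m D"
    proof -
      have "?Z * D = x \<cdot>\<^sub>m D - C * D"
        using C D by (simp add: minus_mult_distrib_mat[of _ p p _ _ p] mult_smult_assoc_mat[of _ p p _ p])
      then show ?thesis unfolding CD using D by (intro eq_matI) (auto simp: algebra_simps)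
    qed
    have K: "four_block_mat M U V (C + D) \<in> carrier_mat (n + p) (n + p)"
      using M C D by auto
    have "?E * G = four_block_mat (1\<^sub>m n * (x \<cdot>\<^sub>m 1\<^sub>m n - M) + 0\<^sub>m n p * ((- 1 / (x - c)) \<cdot>\<^sub>m V))
        (1\<^sub>m n * (- U) + 0\<^sub>m n p * (1\<^sub>m p - (1 / (x - c)) \<cdot>\<^sub>m D))
        (0\<^sub>m p n * (x \<cdot>\<^sub>m 1\<^sub>m n - M) + ?Z * ((- 1 / (x - c)) \<cdot>\<^sub>m V))
        (0\<^sub>m p n * (- U) + ?Z * (1\<^sub>m p - (1 / (x - c)) \<cdot>\<^sub>m D))"
      unfolding G_def
      by (rule mult_four_block_mat[OF one_carrier_mat zero_carrier_mat zero_carrier_mat Z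
            minus_carrier_mat[OF M] uminus_carrier_mat[OF U] smult_carrier_mat[OF V]
            minus_carrier_mat[OF smult_carrier_mat[OF D]]])
    also have "\<dots> = four_block_mat (x \<cdot>\<^sub>m 1\<^sub>m n - M) (- U) (- V) (x \<cdot>\<^sub>m 1\<^sub>m p - (C + D))"
    proof (intro cong_four_block_mat)
      show "0\<^sub>m p n * (x \<cdot>\<^sub>m 1\<^sub>m n - M) + ?Z * ((- 1 / (x - c)) \<cdot>\<^sub>m V) = - V"
        using M V Z xc by (simp add: mult_smult_distrib[OF Z V] ZV) (intro eq_matI; auto)
      have "?Z * (1\<^sub>m p - (1 / (x - c)) \<cdot>\<^sub>m D) = ?Z - D"
      proof -
        have "?Z * (1\<^sub>m p - (1 / (x - c)) \<cdot>\<^sub>m D) = ?Z * 1\<^sub>m p - ?Z * ((1 / (x - c)) \<cdot>\<^sub>m D)"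
          by (rule mult_minus_distrib_mat[OF Z]) (use D in auto)
        also have "\<dots> = ?Z - D"
          using Z D xc by (simp add: right_mult_one_mat[OF Z] mult_smult_distrib[OF Z D] ZD)
            (intro eq_matI; auto)
        finally show ?thesis .
      qed
      then show "0\<^sub>m p n * (- U) + ?Z * (1\<^sub>m p - (1 / (x - c)) \<cdot>\<^sub>m D) = x \<cdot>\<^sub>m 1\<^sub>m p - (C + D)"
        using U C D by simp (intro eq_matI; auto)
    qed (use M U V D in auto)
    also have "\<dots> = x \<cdot>\<^sub>m 1\<^sub>m (n + p) - four_block_mat M U V (C + D)"
      using M U V C D by (intro eq_matI) auto
    finally have "x \<cdot>\<^sub>m 1\<^sub>m (n + p) - four_block_mat M U V (C + D) = ?E * G" by simp
    moreover have "det (?E * G) = det ?E * det G"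
      by (rule det_mult[of _ "n + p"]) (use M D Z in \<open>auto simp: G_def\<close>)
    moreover have "det ?E = det ?Z"
      using det_four_block_mat_upper_right_zero[of "1\<^sub>m n" n _ p "0\<^sub>m p n" ?Z] Z by auto
    ultimately show ?thesis
      by (simp add: poly_char_poly[OF K] poly_char_poly[OF C])
  qed
  show "poly (char_poly (four_block_mat M U V (C1 + D)) * char_poly C2) x =
      poly (char_poly (four_block_mat M U V (C2 + D)) * char_poly C1) x"
    using assms by (simp add: factor)
qed simp

lemma char_poly_four_block_diagonal:
  fixes A B :: "'a :: {field, ring_char_0} mat"
  assumes A: "A \<in> carrier_mat n n" and B: "B \<in> carrier_mat m m"
  shows "char_poly (four_block_mat A (0\<^sub>m n m) (0\<^sub>m m n) B) = char_poly A * char_poly B"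
proof (rule poly_eqI_cofinite[of "{}"])
  fix x :: 'a
  have "x \<cdot>\<^sub>m 1\<^sub>m (n + m) - four_block_mat A (0\<^sub>m n m) (0\<^sub>m m n) B =
      four_block_mat (x \<cdot>\<^sub>m 1\<^sub>m n - A) (0\<^sub>m n m) (0\<^sub>m m n) (x \<cdot>\<^sub>m 1\<^sub>m m - B)"
    using A B by (intro eq_matI) auto
  then show "poly (char_poly (four_block_mat A (0\<^sub>m n m) (0\<^sub>m m n) B)) x = poly (char_poly A * char_poly B) x"
    using A B det_four_block_mat_lower_left_zero[of "x \<cdot>\<^sub>m 1\<^sub>m n - A" n "0\<^sub>m n m" m "0\<^sub>m m n" "x \<cdot>\<^sub>m 1\<^sub>m m - B"]
    by (simp add: poly_char_poly[of _ n] poly_char_poly[of _ m] poly_char_poly[of _ "n + m"] minus_carrier_mat)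
qed simp

section \<open>Traces and Gram matrices\<close>

lemma trace_mult_commute:
  fixes A B :: "'a :: comm_semiring_0 mat"
  assumes "A \<in> carrier_mat n m" "B \<in> carrier_mat m n"
  shows "(\<Sum>i<n. (A * B) $$ (i, i)) = (\<Sum>j<m. (B * A) $$ (j, j))"
proof -
  have "(\<Sum>i<n. (A * B) $$ (i, i)) = (\<Sum>i<n. \<Sum>j<m. A $$ (i, j) * B $$ (j, i))"
    using assms by (intro sum.cong) (auto simp: scalar_prod_def lessThan_atLeast0)
  also have "\<dots> = (\<Sum>j<m. \<Sum>i<n. A $$ (i, j) * B $$ (j, i))"
    by (rule sum.swap)
  also have "\<dots> = (\<Sum>j<m. (B * A) $$ (j, j))"
    using assms by (intro sum.cong) (auto simp: scalar_prod_def lessThan_atLeast0 mult.commute)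
  finally show ?thesis .
qed

text \<open>Schur decomposition makes \<open>A\<close> similar to a matrix whose diagonal lists the
  eigenvalues, and cyclicity of the trace removes the conjugation.\<close>

lemma sum_proots_char_poly:
  fixes A :: "complex mat"
  assumes A: "A \<in> carrier_mat n n"
  shows "\<Sum>\<^sub># (proots (char_poly A)) = (\<Sum>i<n. A $$ (i, i))"
proof -
  obtain es where es: "char_poly A = (\<Prod>a\<leftarrow>es. [:- a, 1:])"
    using char_poly_factorized[OF A] by blast
  obtain B P Q where "schur_decomposition A es = (B, P, Q)"
    by (cases "schur_decomposition A es")
  from schur_decomposition[OF A es this]
  have wit: "similar_mat_wit A B P Q" and diag: "diag_mat B = es" by auto
  note w = similar_mat_witD2[OF A wit]
  have "(\<Sum>i<n. A $$ (i, i)) = (\<Sum>i<n. (P * (B * Q)) $$ (i, i))"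
    using w by (simp add: assoc_mult_mat[of _ n n _ n _ n])
  also have "\<dots> = (\<Sum>i<n. ((B * Q) * P) $$ (i, i))"
    using w by (intro trace_mult_commute) auto
  also have "(B * Q) * P = B"
    using w by (simp add: assoc_mult_mat[of _ n n _ n _ n])
  also have "(\<Sum>i<n. B $$ (i, i)) = sum_list es"
    using w(5) by (simp add: diag[symmetric] diag_mat_def interv_sum_list_conv_sum_set_nat lessThan_atLeast0)
  finally show ?thesis
    using proots_prod_linear_factors[of "\<lambda>x. x" es] by (simp add: es sum_mset_sum_list)
qed

text \<open>For an eigenvector \<open>v\<close> and \<open>y = B\<^sup>T v\<close>, evaluating the
  Hermitian form of \<open>B B\<^sup>T\<close> at \<open>v\<close> in two ways gives \<mu> |v|^2 =
  |y|^2, so \<mu> is a quotient of nonnegative reals.\<close>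

lemma eigenvalue_gram_nonneg:
  fixes B :: "complex mat"
  assumes B: "B \<in> carrier_mat n m" and real: "\<And>i j. i < n \<Longrightarrow> j < m \<Longrightarrow> B $$ (i, j) \<in> \<real>"
    and ev: "eigenvalue (B * transpose_mat B) \<mu>"
  shows "\<mu> \<in> \<real>" "Re \<mu> \<ge> 0"
proof -
  obtain v where v: "v \<in> carrier_vec n" "v \<noteq> 0\<^sub>v n" "(B * transpose_mat B) *\<^sub>v v = \<mu> \<cdot>\<^sub>v v"
    using ev B by (auto simp: eigenvalue_def eigenvector_def)
  define y where "y = transpose_mat B *\<^sub>v v"
  have y: "y \<in> carrier_vec m" using B v by (auto simp: y_def)
  have yj: "y $ j = (\<Sum>i<n. B $$ (i, j) * v $ i)" if "j < m" for j
    using that B v by (simp add: y_def scalar_prod_def lessThan_atLeast0)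
  have By: "B *\<^sub>v y = \<mu> \<cdot>\<^sub>v v"
    unfolding y_def v(3)[symmetric]
    by (rule assoc_mult_mat_vec[symmetric, of _ n m _ n]) (use v B in auto)
  have norm: "of_real ((cmod z)\<^sup>2) = cnj z * z" for z
    by (simp only: complex_norm_square mult.commute)
  have "\<mu> * of_real (\<Sum>i<n. (cmod (v $ i))\<^sup>2) = (\<Sum>i<n. cnj (v $ i) * (\<mu> * v $ i))"
    by (simp only: of_real_sum norm sum_distrib_left mult.left_commute)
  also have "\<dots> = (\<Sum>i<n. cnj (v $ i) * (B *\<^sub>v y) $ i)"
    using v(1) by (simp add: By)
  also have "\<dots> = (\<Sum>i<n. \<Sum>j<m. cnj (v $ i) * (B $$ (i, j) * y $ j))"
    using B y by (intro sum.cong) (auto simp: scalar_prod_def lessThan_atLeast0 sum_distrib_left)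
  also have "\<dots> = (\<Sum>j<m. \<Sum>i<n. cnj (v $ i) * (B $$ (i, j) * y $ j))"
    by (rule sum.swap)
  also have "\<dots> = (\<Sum>j<m. cnj (y $ j) * y $ j)"
  proof (rule sum.cong)
    fix j assume "j \<in> {..<m}"
    \<comment> \<open>Here the entries of \<open>B\<close> have to be real: the transpose then
      serves as the adjoint.\<close>
    then have "cnj (y $ j) = (\<Sum>i<n. cnj (v $ i) * B $$ (i, j))"
      using real by (auto simp: yj Reals_cnj_iff mult.commute intro!: sum.cong)
    then show "(\<Sum>i<n. cnj (v $ i) * (B $$ (i, j) * y $ j)) = cnj (y $ j) * y $ j"
      by (simp only: sum_distrib_right mult.assoc)
  qed simp
  also have "\<dots> = of_real (\<Sum>j<m. (cmod (y $ j))\<^sup>2)"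
    by (simp only: of_real_sum norm)
  finally have eq: "\<mu> * of_real (\<Sum>i<n. (cmod (v $ i))\<^sup>2) = of_real (\<Sum>j<m. (cmod (y $ j))\<^sup>2)" .
  obtain i where "i < n" "v $ i \<noteq> 0"
    using v(1,2) eq_vecI[of v "0\<^sub>v n"] by auto
  then have pos: "(\<Sum>i<n. (cmod (v $ i))\<^sup>2) > 0"
    by (intro sum_pos2[of _ i]) auto
  then have "complex_of_real (\<Sum>i<n. (cmod (v $ i))\<^sup>2) \<noteq> 0"
    by (simp only: of_real_eq_0_iff)
  then have "\<mu> = of_real ((\<Sum>j<m. (cmod (y $ j))\<^sup>2) / (\<Sum>i<n. (cmod (v $ i))\<^sup>2))"
    using eq by (simp only: of_real_divide nonzero_eq_divide_eq simp_thms)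
  moreover have "(\<Sum>j<m. (cmod (y $ j))\<^sup>2) / (\<Sum>i<n. (cmod (v $ i))\<^sup>2) \<ge> 0"
    by (intro divide_nonneg_nonneg sum_nonneg) auto
  ultimately show "\<mu> \<in> \<real>" "Re \<mu> \<ge> 0" by (metis Reals_of_real, metis Re_complex_of_real)
qed

section \<open>Distances and eccentricities\<close>

text \<open>A local certificate for a distance formula. By \<open>lower\<close> the value drops by
  at most one along an arc, so every walk has length at least \<open>d u v\<close>; by
  \<open>upper\<close> some arc makes it drop, so following such arcs gives a walk of that length. A
  closed formula can thus be verified by cases without constructing shortest walks.\<close>

lemma distance_eqI:
  fixes d :: "'a \<Rightarrow> 'a \<Rightarrow> nat"
  assumes "pair_wf_digraph G"
    and zero: "\<And>u. u \<in> pverts G \<Longrightarrow> d u u = 0"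
    and upper: "\<And>u v. \<lbrakk>u \<in> pverts G; v \<in> pverts G; u \<noteq> v\<rbrakk> \<Longrightarrow> \<exists>w. (u, w) \<in> parcs G \<and> Suc (d w v) \<le> d u v"
    and lower: "\<And>u v w. \<lbrakk>(u, w) \<in> parcs G; v \<in> pverts G\<rbrakk> \<Longrightarrow> d u v \<le> Suc (d w v)"
    and "u \<in> pverts G" "v \<in> pverts G"
  shows "distance G u v = d u v"
proof -
  note in_verts = pair_wf_digraph.in_arcsD1[OF assms(1)] pair_wf_digraph.in_arcsD2[OF assms(1)]
  have walk: "pre_digraph.awalk G u p v \<longleftrightarrow> u \<in> pverts G \<and> set p \<subseteq> parcs G \<and> pcas u p v" for u p v
    by (simp add: pre_digraph.awalk_def cas_with_proj_eq)
  have ge: "\<lbrakk>u \<in> pverts G; set p \<subseteq> parcs G; pcas u p v\<rbrakk> \<Longrightarrow> v \<in> pverts G \<and> d u v \<le> length p" for u p v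
  proof (induction p arbitrary: u)
    case Nil
    then show ?case using zero by simp
  next
    case (Cons e p)
    then obtain w where e: "e = (u, w)" "(u, w) \<in> parcs G" "pcas w p v"
      by (cases e) simp
    then have "v \<in> pverts G \<and> d w v \<le> length p"
      using Cons in_verts(2)[OF e(2)] by simp
    then show ?case using lower[OF e(2), of v] by simp
  qed
  \<comment> \<open>Induction on the value \<open>d u v\<close>, which decreases at each step that
    \<open>upper\<close> provides.\<close>
  have ex: "\<lbrakk>u \<in> pverts G; v \<in> pverts G\<rbrakk> \<Longrightarrow> \<exists>p. set p \<subseteq> parcs G \<and> pcas u p v \<and> length p \<le> d u v" for u v
  proof (induction "d u v" arbitrary: u rule: less_induct)
    case less
    show ?case
    proof (cases "u = v")
      case True
      then show ?thesis by (intro exI[of _ "[]"]) simp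
    next
      case False
      obtain w where w: "(u, w) \<in> parcs G" "Suc (d w v) \<le> d u v"
        using upper[OF less.prems False] by blast
      then obtain p where "set p \<subseteq> parcs G" "pcas w p v" "length p \<le> d w v"
        using less.hyps[of w] less.prems(2) in_verts(2)[OF w(1)] by auto
      then show ?thesis
        using w by (intro exI[of _ "(u, w) # p"]) simp
    qed
  qed
  obtain p where p: "set p \<subseteq> parcs G" "pcas u p v" "length p \<le> d u v" using ex assms(5,6) by blast
  have "length p = d u v" using ge[OF assms(5) p(1,2)] p(3) by simp
  then show ?thesis
    unfolding distance_def walk using ge p assms(5) by (intro Least_equality) blast+
qed

text \<open>Collects the few consequences of \<open>pair_graph\<close> used below in a locale that
  can be imported for two graphs at once, as in \<open>bipartite_join\<close>.\<close>

locale simple_graph =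
  fixes G :: "'a pair_pre_digraph"
  assumes pair_graph: "pair_graph G"
begin

lemma arcs_symmetric: "(u, v) \<in> parcs G \<Longrightarrow> (v, u) \<in> parcs G"
  and no_loops': "(u, v) \<in> parcs G \<Longrightarrow> u \<noteq> v"
  and in_arcsD1: "(u, v) \<in> parcs G \<Longrightarrow> u \<in> pverts G"
  and in_arcsD2: "(u, v) \<in> parcs G \<Longrightarrow> v \<in> pverts G"
  and pair_finite_verts [simp]: "finite (pverts G)"
proof -
  note digraph = pair_graph.axioms(1)[OF pair_graph]
  note fin = pair_digraph.axioms(1)[OF digraph]
  note wf = pair_fin_digraph.axioms(1)[OF fin]
  show "(u, v) \<in> parcs G \<Longrightarrow> (v, u) \<in> parcs G"
    by (rule pair_sym_digraph.arcs_symmetric[OF pair_pseudo_graph.axioms(2)[OF pair_graph.axioms(2)[OF pair_graph]]])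
  show "(u, v) \<in> parcs G \<Longrightarrow> u \<noteq> v"
    by (rule pair_loopfree_digraph.no_loops'[OF pair_digraph.axioms(2)[OF digraph]])
  show "(u, v) \<in> parcs G \<Longrightarrow> u \<in> pverts G" "(u, v) \<in> parcs G \<Longrightarrow> v \<in> pverts G"
    by (erule pair_wf_digraph.in_arcsD1[OF wf], erule pair_wf_digraph.in_arcsD2[OF wf])
  show "finite (pverts G)"
    by (rule pair_fin_digraph.pair_finite_verts[OF fin])
qed

lemmas wellformed' = in_arcsD1 in_arcsD2

end

section \<open>Distances and eccentricities in a join along one colour class\<close>

text \<open>The distances of \<open>distance_J\<close>. Two vertices of \<open>X\<close> meet in any
  vertex of \<open>H\<close>. Non-adjacent vertices of different colours are linked by a walk x - h
  - x' - y, hence 3. Two vertices outside \<open>X\<close> are at distance 2 if they share a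
  neighbour; otherwise the detour y - x - h - x' - z gives 4.\<close>

definition join_distance ::
  "'a set \<Rightarrow> 'a pair_pre_digraph \<Rightarrow> 'b pair_pre_digraph \<Rightarrow> 'a + 'b \<Rightarrow> 'a + 'b \<Rightarrow> nat" where
  "join_distance X S H s t =
    (case s of
      Inl a \<Rightarrow> (case t of
          Inl b \<Rightarrow> if a = b then 0
            else if a \<in> X \<and> b \<in> X then 2
            else if a \<in> X \<or> b \<in> X then if (a, b) \<in> parcs S then 1 else 3
            else if \<exists>x. (a, x) \<in> parcs S \<and> (x, b) \<in> parcs S then 2 else 4
        | Inr h \<Rightarrow> if a \<in> X then 1 else 2)
    | Inr h \<Rightarrow> (case t of
          Inl b \<Rightarrow> if b \<in> X then 1 else 2
        | Inr k \<Rightarrow> if h = k then 0 else if (h, k) \<in> parcs H then 1 else 2))"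

text \<open>The block of the eccentricity matrix on the vertices of \<open>S\<close>. That
  \<open>H\<close> does not occur in it is what makes different joins comparable.\<close>

definition join_ecc_block :: "'a set \<Rightarrow> 'a pair_pre_digraph \<Rightarrow> 'a \<Rightarrow> 'a \<Rightarrow> nat" where
  "join_ecc_block X S a b =
    (if a = b \<or> a \<in> X \<and> b \<in> X then 0
     else if a \<in> X \<or> b \<in> X then if (a, b) \<in> parcs S then 0 else 3
     else if \<exists>x. (a, x) \<in> parcs S \<and> (x, b) \<in> parcs S then 0 else 4)"

text \<open>Common setting of both subdivision joins. \<open>neighbour\<close> brings every vertex
  outside \<open>X\<close> within two steps of \<open>H\<close>, which bounds all distances by 4.
  The two non-neighbour conditions give every vertex of \<open>S\<close> eccentricity at least 3,
  whatever \<open>H\<close> is.\<close>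

locale bipartite_join = S: simple_graph S + H: simple_graph H
  for S :: "'a pair_pre_digraph" and X :: "'a set" and H :: "'b pair_pre_digraph" +
  assumes X_subset: "X \<subseteq> pverts S"
    and bipartite: "(a, b) \<in> parcs S \<Longrightarrow> a \<in> X \<longleftrightarrow> b \<notin> X"
    and neighbour: "y \<in> pverts S - X \<Longrightarrow> \<exists>x\<in>X. (y, x) \<in> parcs S"
    and non_neighbour_X: "x \<in> X \<Longrightarrow> \<exists>y\<in>pverts S - X. (x, y) \<notin> parcs S"
    and non_neighbour_Y: "y \<in> pverts S - X \<Longrightarrow> \<exists>x\<in>X. (y, x) \<notin> parcs S"
    and nonempty: "X \<noteq> {}" "pverts H \<noteq> {}"
begin

abbreviation "J \<equiv> join_along X S H"
abbreviation "Y \<equiv> pverts S - X"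

lemma Y_nonempty: "Y \<noteq> {}"
  using nonempty(1) non_neighbour_X by blast

lemma verts_J: "pverts J = pverts S <+> pverts H"
  by (simp add: join_along_def disjoint_union_graph_def)

lemma arcs_J [simp]:
  "(Inl a, Inl b) \<in> parcs J \<longleftrightarrow> (a, b) \<in> parcs S"
  "(Inl a, Inr h) \<in> parcs J \<longleftrightarrow> a \<in> X \<and> h \<in> pverts H"
  "(Inr h, Inl a) \<in> parcs J \<longleftrightarrow> a \<in> X \<and> h \<in> pverts H"
  "(Inr h, Inr k) \<in> parcs J \<longleftrightarrow> (h, k) \<in> parcs H"
  by (auto simp: join_along_def disjoint_union_graph_def)

lemma pair_wf_digraph_J: "pair_wf_digraph J"
proof
  fix e assume "e \<in> parcs J"
  then have "fst e \<in> pverts J \<and> snd e \<in> pverts J"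
    unfolding verts_J using X_subset
    by (cases e; cases "fst e"; cases "snd e") (auto dest: S.wellformed' H.wellformed')
  then show "fst e \<in> pverts J" "snd e \<in> pverts J" by auto
qed

lemma distance_J:
  assumes "s \<in> pverts J" "t \<in> pverts J"
  shows "distance J s t = join_distance X S H s t"
proof (rule distance_eqI[OF pair_wf_digraph_J _ _ _ assms])
  fix s show "join_distance X S H s s = 0"
    by (cases s) (auto simp: join_distance_def)
next
  fix s t w assume st: "(s, w) \<in> parcs J" "t \<in> pverts J"
  show "join_distance X S H s t \<le> Suc (join_distance X S H w t)"
    using st
    by (cases s; cases t; cases w)
      (auto simp: join_distance_def verts_J dest: bipartite S.arcs_symmetric S.no_loops' H.no_loops')
next
  fix s t assume s: "s \<in> pverts J" and t: "t \<in> pverts J" and "s \<noteq> t"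
  \<comment> \<open>Relay vertices: \<open>h0\<close> is the first step from \<open>X\<close>
    towards a non-adjacent vertex of \<open>S\<close>, and \<open>x0\<close> the first step between
    non-adjacent vertices of \<open>H\<close>.\<close>
  obtain h0 where h0: "h0 \<in> pverts H" using nonempty by blast
  obtain x0 where x0: "x0 \<in> X" using nonempty by blast
  show "\<exists>w. (s, w) \<in> parcs J \<and> Suc (join_distance X S H w t) \<le> join_distance X S H s t"
  proof (cases s)
    case s: (Inl a)
    show ?thesis
    proof (cases "a \<in> X")
      case a: True
      show ?thesis
      proof (cases t)
        case t: (Inl b)
        then show ?thesis using s a h0 \<open>s \<noteq> t\<close>
          apply (cases "(a, b) \<in> parcs S")
           apply (rule exI[of _ "Inl b"])
           apply (auto simp: join_distance_def dest: bipartite) []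
          apply (rule exI[of _ "Inr h0"])
          apply (auto simp: join_distance_def)
          done
      next
        case t': (Inr h)
        then show ?thesis using s a t
          by (intro exI[of _ "Inr h"]) (auto simp: join_distance_def verts_J)
      qed
    next
      case a: False
      then have aY: "a \<in> Y" using s \<open>s \<in> pverts J\<close> by (auto simp: verts_J)
      obtain x where x: "x \<in> X" "(a, x) \<in> parcs S" using neighbour[OF aY] by blast
      show ?thesis
      proof (cases t)
        case t: (Inl b)
        show ?thesis
        \<comment> \<open>The target is adjacent to \<open>a\<close> or shares a neighbour with it,
          and then \<open>c\<close> is the right first step. Otherwise the claimed distance is 3 or
          4 and any neighbour \<open>x\<close> in \<open>X\<close> will do, because the rest of the
          route goes through \<open>H\<close>.\<close>
        proof (cases "\<exists>c. (a, c) \<in> parcs S \<and> (c = b \<or> (c, b) \<in> parcs S)")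
          case True
          then obtain c where "(a, c) \<in> parcs S" "c = b \<or> (c, b) \<in> parcs S" by blast
          then show ?thesis using s t a \<open>s \<noteq> t\<close>
            by (intro exI[of _ "Inl c"]) (auto simp: join_distance_def dest: bipartite)
        next
          case False
          then show ?thesis using s t a x \<open>s \<noteq> t\<close>
            by (intro exI[of _ "Inl x"]) (auto simp: join_distance_def dest: bipartite)
        qed
      next
        case t: (Inr h)
        then show ?thesis using s a x
          by (intro exI[of _ "Inl x"]) (auto simp: join_distance_def)
      qed
    qed
  next
    case s': (Inr h)
    have h: "h \<in> pverts H" using s s' by (auto simp: verts_J)
    show ?thesis
    proof (cases t)
      case t': (Inl b)
      show ?thesis
      proof (cases "b \<in> X")
        case True
        then show ?thesis using s' t' h by (intro exI[of _ "Inl b"]) (auto simp: join_distance_def)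
      next
        case False
        then obtain x where "x \<in> X" "(b, x) \<in> parcs S"
          using neighbour[of b] t t' by (auto simp: verts_J)
        then show ?thesis using s' t' h False
          by (intro exI[of _ "Inl x"]) (auto simp: join_distance_def dest: S.arcs_symmetric)
      qed
    next
      case t': (Inr k)
      then show ?thesis using s' t h x0 \<open>s \<noteq> t\<close>
        apply (cases "(h, k) \<in> parcs H")
         apply (rule exI[of _ "Inr k"])
         apply (auto simp: join_distance_def) []
        apply (rule exI[of _ "Inl x0"])
        apply (auto simp: join_distance_def)
        done
    qed
  qed
qed

lemma finite_verts_J: "finite (pverts J)"
  by (simp add: verts_J)

lemma distance_le_eccentricity:
  "\<lbrakk>s \<in> pverts J; t \<in> pverts J\<rbrakk> \<Longrightarrow> join_distance X S H s t \<le> eccentricity J s"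
  unfolding eccentricity_def using finite_verts_J distance_J
  by (metis Max_ge finite_imageI image_eqI)

lemma eccentricity_le:
  assumes "s \<in> pverts J" "\<And>t. t \<in> pverts J \<Longrightarrow> join_distance X S H s t \<le> n"
  shows "eccentricity J s \<le> n"
  unfolding eccentricity_def using finite_verts_J distance_J assms by (subst Max_le_iff) auto

lemma eccentricity_X: "x \<in> X \<Longrightarrow> eccentricity J (Inl x) = 3"
proof (rule antisym)
  assume x: "x \<in> X"
  then have xJ: "Inl x \<in> pverts J" using X_subset by (auto simp: verts_J)
  show "eccentricity J (Inl x) \<le> 3"
    using x by (intro eccentricity_le[OF xJ]) (auto simp: join_distance_def split: sum.split)
  obtain y where "y \<in> Y" "(x, y) \<notin> parcs S" using non_neighbour_X x by blast
  then show "3 \<le> eccentricity J (Inl x)"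
    using distance_le_eccentricity[OF xJ, of "Inl y"] x
    by (auto simp: join_distance_def verts_J InlI split: if_splits)
qed

lemma eccentricity_H: "h \<in> pverts H \<Longrightarrow> eccentricity J (Inr h) = 2"
proof (rule antisym)
  assume "h \<in> pverts H"
  then have hJ: "Inr h \<in> pverts J" by (auto simp: verts_J)
  show "eccentricity J (Inr h) \<le> 2"
    by (intro eccentricity_le[OF hJ]) (auto simp: join_distance_def split: sum.split)
  obtain y where "y \<in> Y" using Y_nonempty by blast
  then show "2 \<le> eccentricity J (Inr h)"
    using distance_le_eccentricity[OF hJ, of "Inl y"] by (auto simp: join_distance_def verts_J)
qed

text \<open>The exact value depends on whether \<open>y\<close> shares a neighbour with every other
  vertex outside \<open>X\<close>. The bounds suffice for all entries of the eccentricity matrix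
  except those equal to 4, for which \<open>eccentricity_Y_eq_4\<close> gives the exact
  value.\<close>

lemma eccentricity_Y:
  assumes "y \<in> Y"
  shows "3 \<le> eccentricity J (Inl y)" "eccentricity J (Inl y) \<le> 4"
proof -
  have yJ: "Inl y \<in> pverts J" using assms by (auto simp: verts_J)
  show "eccentricity J (Inl y) \<le> 4"
    by (intro eccentricity_le[OF yJ]) (auto simp: join_distance_def split: sum.split)
  obtain x where "x \<in> X" "(y, x) \<notin> parcs S" using non_neighbour_Y assms by blast
  then show "3 \<le> eccentricity J (Inl y)"
    using distance_le_eccentricity[OF yJ, of "Inl x"] assms X_subset
    by (auto simp: join_distance_def verts_J InlI subset_iff split: if_splits)
qed

lemma eccentricity_Y_eq_4:
  assumes "y \<in> Y" "z \<in> Y" "y \<noteq> z" "\<nexists>x. (y, x) \<in> parcs S \<and> (x, z) \<in> parcs S"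
  shows "eccentricity J (Inl y) = 4"
  using distance_le_eccentricity[of "Inl y" "Inl z"] eccentricity_Y(2)[OF assms(1)] assms
  by (auto simp: join_distance_def verts_J InlI split: if_splits)

text \<open>If one of the vertices lies in \<open>X\<close>, the smaller eccentricity is 3, so only
  distance 3 survives. For two vertices outside \<open>X\<close>, distances 0 and 2 are below both
  eccentricities, while distance 4 forces both eccentricities to be 4 and survives.\<close>

lemma ecc_entry_Inl_Inl:
  assumes a: "a \<in> pverts S" and b: "b \<in> pverts S"
  shows "ecc_entry J (Inl a) (Inl b) = join_ecc_block X S a b"
proof -
  have d: "distance J (Inl a) (Inl b) = join_distance X S H (Inl a) (Inl b)"
    using a b by (intro distance_J) (auto simp: verts_J)
  have ecc: "c \<in> pverts S \<Longrightarrow> 3 \<le> eccentricity J (Inl c)" for c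
    using eccentricity_X[of c] eccentricity_Y[of c] by (cases "c \<in> X") auto
  show ?thesis
  proof (cases "a \<in> X \<or> b \<in> X")
    case True
    then have "min (eccentricity J (Inl a)) (eccentricity J (Inl b)) = 3"
      using ecc[OF a] ecc[OF b] eccentricity_X by auto
    with True d show ?thesis
      by (auto simp: ecc_entry_def join_ecc_block_def join_distance_def)
  next
    case False
    then have Y: "a \<in> Y" "b \<in> Y" using a b by auto
    show ?thesis
    proof (cases "a = b \<or> (\<exists>x. (a, x) \<in> parcs S \<and> (x, b) \<in> parcs S)")
      case True
      have "3 \<le> min (eccentricity J (Inl a)) (eccentricity J (Inl b))"
        using ecc[OF a] ecc[OF b] by simp
      with True False d show ?thesis
        by (auto simp: ecc_entry_def join_ecc_block_def join_distance_def)
    next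
      case nocommon: False
      then have "\<nexists>x. (b, x) \<in> parcs S \<and> (x, a) \<in> parcs S" by (auto dest: S.arcs_symmetric)
      then have "eccentricity J (Inl a) = 4" "eccentricity J (Inl b) = 4"
        using nocommon Y eccentricity_Y_eq_4[of a b] eccentricity_Y_eq_4[of b a] by auto
      with nocommon False d show ?thesis
        by (auto simp: ecc_entry_def join_ecc_block_def join_distance_def)
    qed
  qed
qed

text \<open>The smaller eccentricity is that of \<open>h\<close>, namely 2; it is the distance from
  \<open>h\<close> to every vertex outside \<open>X\<close>, while vertices of \<open>X\<close> are
  adjacent to \<open>h\<close>.\<close>

lemma ecc_entry_Inl_Inr:
  assumes a: "a \<in> pverts S" and h: "h \<in> pverts H"
  shows "ecc_entry J (Inl a) (Inr h) = (if a \<in> X then 0 else 2)"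
    and "ecc_entry J (Inr h) (Inl a) = (if a \<in> X then 0 else 2)"
proof -
  have "distance J (Inl a) (Inr h) = join_distance X S H (Inl a) (Inr h)"
    "distance J (Inr h) (Inl a) = join_distance X S H (Inr h) (Inl a)"
    using a h by (auto intro!: distance_J simp: verts_J)
  moreover have "eccentricity J (Inr h) = 2" "3 \<le> eccentricity J (Inl a)"
    using eccentricity_X[of a] eccentricity_Y[of a] a eccentricity_H[OF h] by (cases "a \<in> X"; auto)+
  ultimately show "ecc_entry J (Inl a) (Inr h) = (if a \<in> X then 0 else 2)"
    "ecc_entry J (Inr h) (Inl a) = (if a \<in> X then 0 else 2)"
    by (auto simp: ecc_entry_def join_distance_def)
qed

text \<open>All vertices of \<open>H\<close> have eccentricity 2 in the join, so exactly the
  distinct non-adjacent pairs survive: the block is 2(J - I - A(H)).\<close>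

lemma ecc_entry_Inr_Inr:
  assumes h: "h \<in> pverts H" and k: "k \<in> pverts H"
  shows "ecc_entry J (Inr h) (Inr k) = (if h = k \<or> (h, k) \<in> parcs H then 0 else 2)"
proof -
  have "distance J (Inr h) (Inr k) = join_distance X S H (Inr h) (Inr k)"
    using h k by (auto intro!: distance_J simp: verts_J)
  then show ?thesis
    using eccentricity_H h k by (auto simp: ecc_entry_def join_distance_def)
qed

end

text \<open>Isomorphisms carry walks in both directions, hence preserve distances, eccentricities
  and matrix entries; listing the vertices of \<open>H\<close> as images of those of
  \<open>G\<close> gives the same matrix. Through this lemma different spectra also yield the
  non-isomorphism required by \<open>non_ecc_cospectral\<close>.\<close>

lemma digraph_iso_ecc_spectrum:
  assumes "digraph_iso (with_proj G) (with_proj H)" and "finite (pverts G)"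
  shows "ecc_spectrum G = ecc_spectrum H"
proof -
  obtain f where f: "pre_digraph.digraph_isomorphism G f" and H: "with_proj H = app_iso f G"
    using assms(1) by (auto simp: digraph_iso_def)
  have wf: "wf_digraph (with_proj G)"
    using f by (simp add: pre_digraph.digraph_isomorphism_def)
  let ?g = "iso_verts f"
  have inj: "inj_on ?g (pverts G)"
    using f by (auto simp: pre_digraph.digraph_isomorphism_def)
  have verts: "pverts H = ?g ` pverts G"
    using arg_cong[OF H, of verts] by simp
  have dist: "distance H (?g u) (?g v) = distance G u v" if "u \<in> pverts G" "v \<in> pverts G" for u v
  proof -
    have "(\<exists>p. pre_digraph.awalk H (?g u) p (?g v) \<and> length p = n) \<longleftrightarrow> (\<exists>p. pre_digraph.awalk G u p v \<and> length p = n)" for n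
    proof
      assume "\<exists>p. pre_digraph.awalk H (?g u) p (?g v) \<and> length p = n"
      then obtain p where "pre_digraph.awalk (app_iso f G) (?g u) p (?g v)" "length p = n"
        using H by auto
      then show "\<exists>p. pre_digraph.awalk G u p v \<and> length p = n"
        using wf_digraph.awalk_app_isoD[OF wf _ f, of "?g u" p "?g v"] that pre_digraph.iso_verts_inv_iso[OF f]
        by (auto intro!: exI[of _ "map (iso_arcs (pre_digraph.inv_iso G f)) p"])
    next
      assume "\<exists>p. pre_digraph.awalk G u p v \<and> length p = n"
      then show "\<exists>p. pre_digraph.awalk H (?g u) p (?g v) \<and> length p = n"
        using wf_digraph.awalk_app_isoI[OF wf _ f] H by (metis length_map)
    qed
    then show ?thesis by (simp add: distance_def)
  qed
  have ecc: "eccentricity H (?g u) = eccentricity G u" if "u \<in> pverts G" for u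
    unfolding eccentricity_def verts image_image using dist that by (simp cong: image_cong)
  have entry: "ecc_entry H (?g u) (?g v) = ecc_entry G u v" if "u \<in> pverts G" "v \<in> pverts G" for u v
    using dist ecc that by (simp add: ecc_entry_def)
  obtain vs where vs: "distinct vs" "set vs = pverts G"
    using finite_distinct_list[OF assms(2)] by blast
  have "matrix_of (map ?g vs) (ecc_entry H) = matrix_of vs (ecc_entry G)"
    unfolding matrix_of_def by (intro eq_matI) (auto intro!: entry simp flip: vs(2))
  moreover have "distinct (map ?g vs)" "set (map ?g vs) = pverts H"
    using vs inj verts by (auto simp: distinct_map)
  ultimately show ?thesis
    unfolding ecc_spectrum_def using vs spectrum_on_eq by metis
qed

section \<open>Line graphs and subdivision graphs\<close>

context simple_graph
begin

lemma edge_iff_arc: "{u, v} \<in> edges G \<longleftrightarrow> (u, v) \<in> parcs G"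
  by (auto simp: edges_def doubleton_eq_iff dest: arcs_symmetric)

lemma edgeE:
  assumes "e \<in> edges G"
  obtains u v where "e = {u, v}" "(u, v) \<in> parcs G" "u \<noteq> v" "u \<in> pverts G" "v \<in> pverts G"
  using assms by (auto simp: edges_def dest: wellformed' no_loops')

lemma edge_subset_verts: "e \<in> edges G \<Longrightarrow> e \<subseteq> pverts G"
  by (auto elim!: edgeE)

lemma finite_edges: "finite (edges G)"
  by (rule finite_subset[of _ "Pow (pverts G)"]) (use edge_subset_verts in auto)

lemma card_edge: "e \<in> edges G \<Longrightarrow> card e = 2"
  by (auto elim!: edgeE)

lemma finite_edge: "e \<in> edges G \<Longrightarrow> finite e"
  by (auto elim!: edgeE)

lemma out_degree_eq_card_neighbours: "out_degree G v = card {w. (v, w) \<in> parcs G}"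
proof -
  have "out_arcs G v = Pair v ` {w. (v, w) \<in> parcs G}"
    by (auto simp: out_arcs_def)
  then show ?thesis
    by (simp add: out_degree_def card_image inj_on_def)
qed

lemma card_incident_edges: "card {e \<in> edges G. v \<in> e} = out_degree G v"
proof -
  have "{e \<in> edges G. v \<in> e} = (\<lambda>w. {v, w}) ` {w. (v, w) \<in> parcs G}"
    by (auto elim!: edgeE simp: edge_iff_arc dest: arcs_symmetric)
  then show ?thesis
    by (simp add: out_degree_eq_card_neighbours card_image inj_on_def doubleton_eq_iff)
qed

lemma card_edges_containing_both:
  assumes "u \<noteq> v"
  shows "card {e \<in> edges G. u \<in> e \<and> v \<in> e} = adjacency_entry G u v"
proof -
  have "{e \<in> edges G. u \<in> e \<and> v \<in> e} = (if (u, v) \<in> parcs G then {{u, v}} else {})"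
    using assms by (auto elim!: edgeE simp: edge_iff_arc dest: arcs_symmetric)
  then show ?thesis by (simp add: adjacency_entry_def)
qed

text \<open>Distinct two-element sets share at most one element. This identifies the off-diagonal
  entries of \<open>B\<^sup>T B\<close>, for the incidence matrix \<open>B\<close>, with adjacency
  in the line graph.\<close>

lemma card_edge_Int:
  assumes e: "e \<in> edges G" and f: "f \<in> edges G" and "e \<noteq> f"
  shows "card (e \<inter> f) = adjacency_entry (line_graph G) e f"
proof -
  have "card (e \<inter> f) \<noteq> 2"
    using card_edge[OF e] card_edge[OF f] finite_edge[OF e] finite_edge[OF f] \<open>e \<noteq> f\<close>
    by (metis Int_lower1 Int_lower2 card_subset_eq)
  moreover have "card (e \<inter> f) \<le> 2"
    using card_mono[OF finite_edge[OF e], of "e \<inter> f"] card_edge[OF e] by simp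
  moreover have "card (e \<inter> f) = 0 \<longleftrightarrow> e \<inter> f = {}"
    using finite_edge[OF e] by simp
  ultimately show ?thesis
    using assms by (auto simp: adjacency_entry_def line_graph_def)
qed

text \<open>Double counting of the incident pairs of a vertex and an edge.\<close>

lemma handshake:
  assumes "regular_graph G r"
  shows "r * order_of G = 2 * card (edges G)"
proof -
  have "(\<Sum>v\<in>pverts G. card {e \<in> edges G. v \<in> e}) = 2 * card (edges G)"
  proof (rule sum_multicount)
    show "\<forall>e\<in>edges G. card {v \<in> pverts G. v \<in> e} = 2"
    proof
      fix e assume e: "e \<in> edges G"
      then have "{v \<in> pverts G. v \<in> e} = e" using edge_subset_verts by auto
      then show "card {v \<in> pverts G. v \<in> e} = 2" using card_edge[OF e] by simp
    qed
  qed (simp_all add: finite_edges)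
  then show ?thesis
    using assms by (simp add: card_incident_edges regular_graph_def mult.commute)
qed

lemma pair_graph_line_graph: "pair_graph (line_graph G)"
proof
  show "finite (parcs (line_graph G))"
    by (rule finite_subset[of _ "edges G \<times> edges G"]) (auto simp: line_graph_def finite_edges)
  show "symmetric (with_proj (line_graph G))"
    by (auto simp: symmetric_def line_graph_def sym_def)
qed (auto simp: line_graph_def finite_edges)

text \<open>Each end of \<open>e\<close> lies on \<open>r - 1\<close> further edges, and the two
  families are disjoint since an edge containing both ends of \<open>e\<close> is
  \<open>e\<close>.\<close>

lemma regular_line_graph:
  assumes "regular_graph G r"
  shows "regular_graph (line_graph G) (2 * (r - 1))"
  unfolding regular_graph_def
proof
  note L = simple_graph.intro[OF pair_graph_line_graph]
  fix e assume "e \<in> pverts (line_graph G)"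
  then have e: "e \<in> edges G" by (simp add: line_graph_def)
  have "out_degree (line_graph G) e = card (\<Union>v\<in>e. {f \<in> edges G. v \<in> f} - {e})"
    unfolding simple_graph.out_degree_eq_card_neighbours[OF L] using e
    by (intro arg_cong[of _ _ card]) (auto simp: line_graph_def)
  also have "\<dots> = (\<Sum>v\<in>e. card ({f \<in> edges G. v \<in> f} - {e}))"
  proof (rule card_UN_disjoint)
    have "f = e" if "f \<in> edges G" "u \<in> f" "v \<in> f" "u \<in> e" "v \<in> e" "u \<noteq> v" for f u v
      using that e by (auto elim!: edgeE)
    then show "\<forall>u\<in>e. \<forall>v\<in>e. u \<noteq> v \<longrightarrow>
        ({f \<in> edges G. u \<in> f} - {e}) \<inter> ({f \<in> edges G. v \<in> f} - {e}) = {}"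
      by blast
  qed (use finite_edge[OF e] finite_edges in auto)
  also have "\<dots> = (\<Sum>v\<in>e. r - 1)"
    using e assms edge_subset_verts[OF e] finite_edges
    by (intro sum.cong) (auto simp: card_Diff_singleton card_incident_edges regular_graph_def)
  also have "\<dots> = 2 * (r - 1)" by (simp add: card_edge[OF e])
  finally show "out_degree (line_graph G) e = 2 * (r - 1)" .
qed

section \<open>Subdivision graphs\<close>

lemma pair_graph_subdivision_graph: "pair_graph (subdivision_graph G)"
proof
  show "finite (parcs (subdivision_graph G))"
    by (rule finite_subset[of _ "(pverts G <+> edges G) \<times> (pverts G <+> edges G)"])
      (use edge_subset_verts in \<open>auto simp: subdivision_graph_def subset_iff\<close>, simp add: finite_edges)
  show "symmetric (with_proj (subdivision_graph G))"
    by (auto simp: symmetric_def subdivision_graph_def sym_def)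
qed (auto simp: subdivision_graph_def finite_edges dest: subsetD[OF edge_subset_verts])

lemma subdivision_arcs:
  "(Inl v, Inr e) \<in> parcs (subdivision_graph G) \<longleftrightarrow> e \<in> edges G \<and> v \<in> e"
  "(Inr e, Inl v) \<in> parcs (subdivision_graph G) \<longleftrightarrow> e \<in> edges G \<and> v \<in> e"
  "(Inl u, Inl v) \<notin> parcs (subdivision_graph G)"
  "(Inr e, Inr f) \<notin> parcs (subdivision_graph G)"
  by (auto simp: subdivision_graph_def)

lemma other_neighbour:
  assumes "out_degree G u \<ge> 2"
  obtains w where "(u, w) \<in> parcs G" "w \<noteq> v"
proof -
  have "\<not> {w. (u, w) \<in> parcs G} \<subseteq> {v}"
    using assms card_mono[of "{v}" "{w. (u, w) \<in> parcs G}"] by (auto simp: out_degree_eq_card_neighbours)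
  then show thesis using that by blast
qed

text \<open>On a path v - u - w with \<open>w \<noteq> v\<close> the second edge misses
  \<open>v\<close>. Together with \<open>non_incident_vertex\<close> this supplies the non-neighbour
  conditions of \<open>bipartite_join\<close>; minimum degree 2 provides \<open>w\<close>.\<close>

lemma non_incident_edge:
  assumes "\<forall>u\<in>pverts G. out_degree G u \<ge> 2" and "v \<in> pverts G"
  shows "\<exists>e\<in>edges G. v \<notin> e"
proof -
  obtain u where "(v, u) \<in> parcs G" using other_neighbour assms by metis
  moreover from this obtain w where "(u, w) \<in> parcs G" "w \<noteq> v"
    using other_neighbour assms wellformed' by metis
  ultimately show ?thesis
    by (intro bexI[of _ "{u, w}"]) (auto simp: edge_iff_arc dest: no_loops')
qed

lemma non_incident_vertex:
  assumes "\<forall>u\<in>pverts G. out_degree G u \<ge> 2" and "e \<in> edges G"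
  shows "\<exists>v\<in>pverts G. v \<notin> e"
proof -
  obtain u v where "e = {u, v}" "u \<in> pverts G" using assms edgeE by metis
  moreover from this obtain w where "(u, w) \<in> parcs G" "w \<noteq> v"
    using other_neighbour assms by metis
  ultimately show ?thesis
    by (intro bexI[of _ w]) (auto dest: wellformed' no_loops')
qed

end

section \<open>Disjoint unions\<close>

lemma pair_graph_disjoint_union:
  assumes "pair_graph G" "pair_graph H"
  shows "pair_graph (disjoint_union_graph G H)"
proof -
  have G: "simple_graph G" by (rule simple_graph.intro) fact
  have H: "simple_graph H" by (rule simple_graph.intro) fact
  show ?thesis
  proof
    show "finite (parcs (disjoint_union_graph G H))"
      by (rule finite_subset[of _ "(pverts G <+> pverts H) \<times> (pverts G <+> pverts H)"])
        (auto simp: disjoint_union_graph_def dest: simple_graph.wellformed'[OF G] simple_graph.wellformed'[OF H]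
          simp: simple_graph.pair_finite_verts[OF G] simple_graph.pair_finite_verts[OF H])
    show "symmetric (with_proj (disjoint_union_graph G H))"
      by (auto simp: symmetric_def disjoint_union_graph_def sym_def dest: simple_graph.arcs_symmetric[OF G] simple_graph.arcs_symmetric[OF H])
  qed (auto simp: disjoint_union_graph_def dest: simple_graph.wellformed'[OF G] simple_graph.wellformed'[OF H] simple_graph.no_loops'[OF G] simple_graph.no_loops'[OF H]
      simp: simple_graph.pair_finite_verts[OF G] simple_graph.pair_finite_verts[OF H])
qed

lemma regular_disjoint_union:
  assumes "pair_graph G" "pair_graph H" "regular_graph G r" "regular_graph H r"
  shows "regular_graph (disjoint_union_graph G H) r"
proof -
  have G: "simple_graph G" by (rule simple_graph.intro) fact
  have H: "simple_graph H" by (rule simple_graph.intro) fact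
  have U: "simple_graph (disjoint_union_graph G H)"
    using assms by (intro simple_graph.intro pair_graph_disjoint_union)
  have nbrs: "{t. (Inl v, t) \<in> parcs (disjoint_union_graph G H)} = Inl ` {w. (v, w) \<in> parcs G}"
    "{t. (Inr h, t) \<in> parcs (disjoint_union_graph G H)} = Inr ` {k. (h, k) \<in> parcs H}" for v h
    by (auto simp: disjoint_union_graph_def)
  have verts: "pverts (disjoint_union_graph G H) = pverts G <+> pverts H"
    by (simp add: disjoint_union_graph_def)
  show ?thesis
    using assms
    by (auto simp: regular_graph_def verts simple_graph.out_degree_eq_card_neighbours[OF U] nbrs
        simple_graph.out_degree_eq_card_neighbours[OF G] simple_graph.out_degree_eq_card_neighbours[OF H] card_image)
qed

section \<open>Adjacency spectra and eccentricity spectra\<close>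

lemma sum_nth_distinct:
  assumes "distinct vs"
  shows "(\<Sum>i<length vs. f (vs ! i)) = (\<Sum>x\<in>set vs. f x)"
  using sum.reindex_bij_betw[OF bij_betw_nth[OF assms refl refl]] .

lemma matrix_of_carrier [simp]: "matrix_of vs m \<in> carrier_mat (length vs) (length vs)"
  and dim_matrix_of [simp]: "dim_row (matrix_of vs m) = length vs" "dim_col (matrix_of vs m) = length vs"
  and index_matrix_of [simp]: "\<lbrakk>i < length vs; j < length vs\<rbrakk> \<Longrightarrow> matrix_of vs m $$ (i, j) = of_nat (m (vs ! i) (vs ! j))"
  by (auto simp: matrix_of_def)

section \<open>Incidence matrices and spectra of line graphs\<close>

definition incidence_mat :: "'a list \<Rightarrow> 'a set list \<Rightarrow> complex mat" where
  "incidence_mat vs es = mat (length vs) (length es) (\<lambda>(i, j). if vs ! i \<in> es ! j then 1 else 0)"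

lemma incidence_mat_carrier: "incidence_mat vs es \<in> carrier_mat (length vs) (length es)"
  by (simp add: incidence_mat_def)

context simple_graph
begin

lemma sum_adjacency_entry:
  assumes "v \<in> pverts G"
  shows "(\<Sum>w\<in>pverts G. adjacency_entry G v w) = out_degree G v"
proof -
  have "(\<Sum>w\<in>pverts G. adjacency_entry G v w) = card {w \<in> pverts G. (v, w) \<in> parcs G}"
    by (simp add: adjacency_entry_def sum.If_cases Int_def)
  also have "{w \<in> pverts G. (v, w) \<in> parcs G} = {w. (v, w) \<in> parcs G}"
    by (auto dest: wellformed')
  finally show ?thesis by (simp add: out_degree_eq_card_neighbours)
qed

text \<open>Says entrywise that the all-ones vector is an eigenvector of the adjacency matrix for
  the eigenvalue \<open>k\<close>.\<close>

lemma adjacency_row_sum: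
  assumes "regular_graph G k" "distinct vs" "set vs = pverts G" "i < length vs"
  shows "(\<Sum>j<length vs. matrix_of vs (adjacency_entry G) $$ (i, j)) = of_nat k"
proof -
  have v: "vs ! i \<in> pverts G" using nth_mem[OF assms(4)] assms(3) by simp
  have "(\<Sum>j<length vs. matrix_of vs (adjacency_entry G) $$ (i, j)) =
      of_nat (\<Sum>j<length vs. adjacency_entry G (vs ! i) (vs ! j))"
    using assms by simp
  also have "(\<Sum>j<length vs. adjacency_entry G (vs ! i) (vs ! j)) = k"
    using sum_nth_distinct[OF assms(2), of "adjacency_entry G (vs ! i)"] sum_adjacency_entry[OF v] assms v
    by (simp add: regular_graph_def)
  finally show ?thesis .
qed

lemma size_adjacency_spectrum: "size (adjacency_spectrum G) = order_of G"
proof -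
  obtain vs where vs: "distinct vs" "set vs = pverts G"
    using finite_distinct_list[OF pair_finite_verts] by blast
  then show ?thesis
    using degree_monic_char_poly[OF matrix_of_carrier[of vs "adjacency_entry G"]] distinct_card[OF vs(1)]
    by (simp add: adjacency_spectrum_def spectrum_on_eq[OF vs] size_proots_complex)
qed

lemma sum_adjacency_spectrum: "\<Sum>\<^sub># (adjacency_spectrum G) = 0"
proof -
  obtain vs where vs: "distinct vs" "set vs = pverts G"
    using finite_distinct_list[OF pair_finite_verts] by blast
  have "adjacency_entry G v v = 0" for v
    by (auto simp: adjacency_entry_def dest: no_loops')
  then show ?thesis
    using sum_proots_char_poly[OF matrix_of_carrier[of vs "adjacency_entry G"]]
    by (simp add: adjacency_spectrum_def spectrum_on_eq[OF vs])
qed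

text \<open>Entry \<open>(i, j)\<close> counts the edges through both vertices: the degree on the
  diagonal, adjacency elsewhere. The scalar 1 gives the right-hand side the shape expected by
  \<open>proots_char_poly_affine\<close>.\<close>

lemma incidence_times_transpose:
  assumes vs: "distinct vs" "set vs = pverts G" and es: "distinct es" "set es = edges G"
    and regular: "regular_graph G r"
  shows "incidence_mat vs es * transpose_mat (incidence_mat vs es) =
    1 \<cdot>\<^sub>m matrix_of vs (adjacency_entry G) + of_nat r \<cdot>\<^sub>m 1\<^sub>m (length vs)" (is "?L = ?R")
proof (rule eq_matI)
  fix i j assume "i < dim_row ?R" "j < dim_col ?R"
  then have i: "i < length vs" and j: "j < length vs" by auto
  have "?L $$ (i, j) = (\<Sum>k<length es. if vs ! i \<in> es ! k \<and> vs ! j \<in> es ! k then 1 else 0)"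
    using i j by (auto simp: incidence_mat_def scalar_prod_def lessThan_atLeast0 intro!: sum.cong)
  also have "\<dots> = (\<Sum>e\<in>edges G. if vs ! i \<in> e \<and> vs ! j \<in> e then 1 else 0)"
    using sum_nth_distinct[OF es(1), of "\<lambda>e. if vs ! i \<in> e \<and> vs ! j \<in> e then 1 else 0 :: complex"] es by simp
  also have "\<dots> = of_nat (card {e \<in> edges G. vs ! i \<in> e \<and> vs ! j \<in> e})"
    by (simp add: sum.If_cases finite_edges Int_def)
  also have "\<dots> = ?R $$ (i, j)"
  proof (cases "i = j")
    case True
    have "vs ! i \<in> pverts G" using nth_mem[OF i] vs(2) by simp
    then show ?thesis
      using i True regular
      by (auto simp: card_incident_edges regular_graph_def adjacency_entry_def dest: no_loops')
  next
    case False
    then have "vs ! i \<noteq> vs ! j" using i j vs by (simp add: nth_eq_iff_index_eq)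
    then show ?thesis using i j False by (simp add: card_edges_containing_both)
  qed
  finally show "?L $$ (i, j) = ?R $$ (i, j)" .
next
  show "dim_row ?L = dim_row ?R" by (simp add: incidence_mat_def)
next
  show "dim_col ?L = dim_col ?R" by (simp add: incidence_mat_def)
qed

text \<open>Entry \<open>(i, j)\<close> is the size of the intersection of two edges: 2 on the
  diagonal, adjacency in the line graph elsewhere.\<close>

lemma transpose_times_incidence:
  assumes vs: "distinct vs" "set vs = pverts G" and es: "distinct es" "set es = edges G"
  shows "transpose_mat (incidence_mat vs es) * incidence_mat vs es =
    1 \<cdot>\<^sub>m matrix_of es (adjacency_entry (line_graph G)) + 2 \<cdot>\<^sub>m 1\<^sub>m (length es)" (is "?L = ?R")
proof (rule eq_matI)
  fix i j assume "i < dim_row ?R" "j < dim_col ?R"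
  then have i: "i < length es" and j: "j < length es" by auto
  have e: "es ! i \<in> edges G" "es ! j \<in> edges G" using nth_mem[OF i] nth_mem[OF j] es(2) by simp_all
  have "?L $$ (i, j) = (\<Sum>k<length vs. if vs ! k \<in> es ! i \<inter> es ! j then 1 else 0)"
    using i j by (auto simp: incidence_mat_def scalar_prod_def lessThan_atLeast0 intro!: sum.cong)
  also have "\<dots> = (\<Sum>v\<in>pverts G. if v \<in> es ! i \<inter> es ! j then 1 else 0)"
    using sum_nth_distinct[OF vs(1), of "\<lambda>v. if v \<in> es ! i \<inter> es ! j then 1 else 0 :: complex"] vs by simp
  also have "\<dots> = of_nat (card {v \<in> pverts G. v \<in> es ! i \<inter> es ! j})"
    by (simp add: sum.If_cases Int_def)
  also have "{v \<in> pverts G. v \<in> es ! i \<inter> es ! j} = es ! i \<inter> es ! j"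
    using edge_subset_verts e by blast
  also have "of_nat (card (es ! i \<inter> es ! j)) = ?R $$ (i, j)"
  proof (cases "i = j")
    case True
    then show ?thesis
      using i card_edge e by (simp add: adjacency_entry_def line_graph_def)
  next
    case False
    then have "es ! i \<noteq> es ! j" using i j es by (simp add: nth_eq_iff_index_eq)
    then show ?thesis using i j False e by (simp add: card_edge_Int)
  qed
  finally show "?L $$ (i, j) = ?R $$ (i, j)" .
next
  show "dim_row ?L = dim_row ?R" by (simp add: incidence_mat_def)
next
  show "dim_col ?L = dim_col ?R" by (simp add: incidence_mat_def)
qed

text \<open>\<open>B B\<^sup>T\<close> and \<open>B\<^sup>T B\<close> have the same eigenvalues up
  to the multiplicity of 0. Padding both sides with copies of -2 keeps the statement free of
  multiset differences, whichever of the two orders is larger.\<close>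

lemma line_graph_spectrum:
  assumes "regular_graph G r"
  shows "adjacency_spectrum (line_graph G) + replicate_mset (order_of G) (- 2) =
    image_mset (\<lambda>x. x + of_nat r - 2) (adjacency_spectrum G) + replicate_mset (card (edges G)) (- 2)"
proof -
  obtain vs where vs: "distinct vs" "set vs = pverts G"
    using finite_distinct_list[OF pair_finite_verts] by blast
  obtain es where es: "distinct es" "set es = edges G"
    using finite_distinct_list[OF finite_edges] by blast
  let ?B = "incidence_mat vs es"
  have B: "?B \<in> carrier_mat (length vs) (length es)" and Bt: "transpose_mat ?B \<in> carrier_mat (length es) (length vs)"
    by (simp_all add: incidence_mat_carrier)
  have len: "length vs = order_of G" "length es = card (edges G)"
    using distinct_card[OF vs(1)] distinct_card[OF es(1)] vs es by auto
  have nz: "char_poly (?B * transpose_mat ?B) \<noteq> 0" "char_poly (transpose_mat ?B * ?B) \<noteq> 0"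
    using char_poly_neq_0[OF mult_carrier_mat[OF B Bt]] char_poly_neq_0[OF mult_carrier_mat[OF Bt B]] .
  have "proots (monom 1 (length es) * char_poly (?B * transpose_mat ?B)) =
      proots (monom 1 (length vs) * char_poly (transpose_mat ?B * ?B))"
    using char_poly_mult_commute[OF B Bt] by simp
  then have "replicate_mset (length es) 0 + proots (char_poly (?B * transpose_mat ?B)) =
      replicate_mset (length vs) 0 + proots (char_poly (transpose_mat ?B * ?B))"
    using nz by (simp add: proots_mult monom_eq_0_iff proots_monom)
  then have "replicate_mset (length es) 0 + image_mset (\<lambda>x. 1 * x + of_nat r) (adjacency_spectrum G) =
      replicate_mset (length vs) 0 + image_mset (\<lambda>x. 1 * x + 2) (adjacency_spectrum (line_graph G))"
    using es
    by (simp only: incidence_times_transpose[OF vs es assms] transpose_times_incidence[OF vs es]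
        proots_char_poly_affine[OF matrix_of_carrier] adjacency_spectrum_def spectrum_on_eq[OF vs])
      (simp add: spectrum_on_eq line_graph_def)
  \<comment> \<open>Subtracting 2 turns the eigenvalues of \<open>B\<^sup>T B\<close> into those of
    the line graph and the padding zeros into -2.\<close>
  then have "image_mset (\<lambda>x. x - 2) (replicate_mset (length es) 0 + image_mset (\<lambda>x. 1 * x + of_nat r) (adjacency_spectrum G)) =
      image_mset (\<lambda>x. x - 2) (replicate_mset (length vs) 0 + image_mset (\<lambda>x. 1 * x + 2) (adjacency_spectrum (line_graph G)))"
    by simp
  then show ?thesis
    by (simp add: len image_mset.compositionality o_def add.commute)
qed

text \<open>\<open>A(G) + r I\<close> is the Gram matrix \<open>B B\<^sup>T\<close>, so its
  eigenvalues are real and nonnegative.\<close>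

lemma adjacency_spectrum_bound:
  assumes "regular_graph G r" and "x \<in># adjacency_spectrum G"
  shows "x \<in> \<real>" "Re x \<ge> - real r"
proof -
  obtain vs where vs: "distinct vs" "set vs = pverts G"
    using finite_distinct_list[OF pair_finite_verts] by blast
  obtain es where es: "distinct es" "set es = edges G"
    using finite_distinct_list[OF finite_edges] by blast
  let ?B = "incidence_mat vs es"
  have BB: "?B * transpose_mat ?B \<in> carrier_mat (length vs) (length vs)"
    by (rule mult_carrier_mat[of _ _ "length es"]) (simp_all add: incidence_mat_carrier)
  have "proots (char_poly (?B * transpose_mat ?B)) = image_mset (\<lambda>x. 1 * x + of_nat r) (adjacency_spectrum G)"
    by (simp only: incidence_times_transpose[OF vs es assms(1)]
        proots_char_poly_affine[OF matrix_of_carrier] adjacency_spectrum_def spectrum_on_eq[OF vs])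
  then have "x + of_nat r \<in># proots (char_poly (?B * transpose_mat ?B))"
    using assms(2) by auto
  then have "eigenvalue (?B * transpose_mat ?B) (x + of_nat r)"
    using char_poly_neq_0[OF BB] by (simp add: eigenvalue_root_char_poly[OF BB])
  then have "x + of_nat r \<in> \<real>" "Re (x + of_nat r) \<ge> 0"
    by (rule eigenvalue_gram_nonneg[OF incidence_mat_carrier, rotated]; auto simp: incidence_mat_def)+
  then show "x \<in> \<real>" "Re x \<ge> - real r"
    by (auto simp: complex_is_Real_iff)
qed

end

section \<open>Block matrices of disjoint unions and joins\<close>

lemma adjacency_spectrum_disjoint_union:
  assumes "finite (pverts G)" "finite (pverts H)"
  shows "adjacency_spectrum (disjoint_union_graph G H) = adjacency_spectrum G + adjacency_spectrum H"
proof -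
  obtain vs where vs: "distinct vs" "set vs = pverts G"
    using finite_distinct_list[OF assms(1)] by blast
  obtain ws where ws: "distinct ws" "set ws = pverts H"
    using finite_distinct_list[OF assms(2)] by blast
  let ?U = "disjoint_union_graph G H"
  let ?l = "map Inl vs @ map Inr ws"
  have l: "distinct ?l" "set ?l = pverts ?U"
    using vs ws by (auto simp: distinct_map disjoint_union_graph_def)
  have entry: "adjacency_entry ?U (Inl u) (Inl v) = adjacency_entry G u v"
    "adjacency_entry ?U (Inr h) (Inr k) = adjacency_entry H h k"
    "adjacency_entry ?U (Inl u) (Inr h) = 0" "adjacency_entry ?U (Inr h) (Inl u) = 0" for u v h k
    by (auto simp: adjacency_entry_def disjoint_union_graph_def)
  have "matrix_of ?l (adjacency_entry ?U) =
      four_block_mat (matrix_of vs (adjacency_entry G)) (0\<^sub>m (length vs) (length ws))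
        (0\<^sub>m (length ws) (length vs)) (matrix_of ws (adjacency_entry H))"
    by (rule eq_matI) (auto simp: nth_append entry)
  then have "char_poly (matrix_of ?l (adjacency_entry ?U)) =
      char_poly (matrix_of vs (adjacency_entry G)) * char_poly (matrix_of ws (adjacency_entry H))"
    by (simp add: char_poly_four_block_diagonal[OF matrix_of_carrier matrix_of_carrier])
  then show ?thesis
    by (simp add: adjacency_spectrum_def spectrum_on_eq[OF l] spectrum_on_eq[OF vs] spectrum_on_eq[OF ws]
        proots_mult char_poly_neq_0[OF matrix_of_carrier])
qed

text \<open>The lower right block 2(J - I - A(H)) is split into -2 A(H) - 2 I and the constant
  matrix 2 J, which take the roles of \<open>C1\<close> and \<open>D\<close> in
  \<open>char_poly_four_block_exchange\<close>.\<close>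

lemma (in bipartite_join) ecc_matrix_J:
  assumes xs: "distinct xs" "set xs = pverts S" and hs: "distinct hs" "set hs = pverts H"
  shows "matrix_of (map Inl xs @ map Inr hs) (ecc_entry J) =
    four_block_mat (matrix_of xs (join_ecc_block X S))
      (mat (length xs) (length hs) (\<lambda>(i, j). if xs ! i \<in> X then 0 else 2))
      (mat (length hs) (length xs) (\<lambda>(i, j). if xs ! j \<in> X then 0 else 2))
      ((- 2 \<cdot>\<^sub>m matrix_of hs (adjacency_entry H) + - 2 \<cdot>\<^sub>m 1\<^sub>m (length hs)) +
        mat (length hs) (length hs) (\<lambda>_. 2))" (is "?L = ?R")
proof (rule eq_matI)
  let ?n = "length xs" and ?p = "length hs"
  fix i j assume "i < dim_row ?R" "j < dim_col ?R"
  then have ij: "i < ?n + ?p" "j < ?n + ?p" by (simp, simp)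
  have entry: "?L $$ (i, j) = of_nat (ecc_entry J ((map Inl xs @ map Inr hs) ! i) ((map Inl xs @ map Inr hs) ! j))"
    using ij by simp
  have xsi: "k < ?n \<Longrightarrow> xs ! k \<in> pverts S" for k using nth_mem[of k xs] xs(2) by simp
  have hsi: "k - ?n < ?p \<Longrightarrow> hs ! (k - ?n) \<in> pverts H" for k using nth_mem[of "k - ?n" hs] hs(2) by simp
  show "?L $$ (i, j) = ?R $$ (i, j)"
  proof (cases "i < ?n")
    case i: True
    show ?thesis
    proof (cases "j < ?n")
      case True
      then show ?thesis using i entry xsi by (simp add: nth_append ecc_entry_Inl_Inl)
    next
      case False
      then have "j - ?n < ?p" using ij by linarith
      with False show ?thesis using i entry xsi hsi by (simp add: nth_append ecc_entry_Inl_Inr)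
    qed
  next
    case i: False
    then have i': "i - ?n < ?p" using ij by linarith
    show ?thesis
    proof (cases "j < ?n")
      case True
      then show ?thesis using i i' entry xsi hsi by (simp add: nth_append ecc_entry_Inl_Inr)
    next
      case False
      then have j': "j - ?n < ?p" using ij by linarith
      have "hs ! (i - ?n) = hs ! (j - ?n) \<longleftrightarrow> i - ?n = j - ?n"
        using i' j' hs(1) by (simp add: nth_eq_iff_index_eq)
      moreover have "(h, h) \<notin> parcs H" for h
        using H.no_loops' by blast
      moreover have "?L $$ (i, j) = of_nat (ecc_entry J (Inr (hs ! (i - ?n))) (Inr (hs ! (j - ?n))))"
        using i False i' j' entry by (simp add: nth_append)
      ultimately show ?thesis
        using i False i' j' hsi[of i] hsi[of j] by (simp add: ecc_entry_Inr_Inr adjacency_entry_def)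
    qed
  qed
next
  show "dim_row ?L = dim_row ?R" by simp
next
  show "dim_col ?L = dim_col ?R" by simp
qed

text \<open>Both joins have the same upper blocks and the same lower left block. Regularity makes
  the constant columns of \<open>V\<close> and \<open>D\<close> eigenvectors of -2 A(H) - 2 I for
  the eigenvalue \<open>- 2 * k - 2\<close>, so the parts of the spectra that depend on
  \<open>H1\<close> and \<open>H2\<close> can be exchanged.\<close>

lemma join_spectrum_exchange:
  assumes "bipartite_join S X H1" "bipartite_join S X H2"
    and "regular_graph H1 k" "regular_graph H2 k" "order_of H1 = order_of H2"
  shows "ecc_spectrum (join_along X S H1) + image_mset (\<lambda>x. - 2 * x - 2) (adjacency_spectrum H2) =
    ecc_spectrum (join_along X S H2) + image_mset (\<lambda>x. - 2 * x - 2) (adjacency_spectrum H1)"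
proof -
  note J1 = assms(1)
  note J1S = bipartite_join.axioms(1)[OF J1]
  note J1H = bipartite_join.axioms(2)[OF J1]
  note J2 = assms(2)
  note J2H = bipartite_join.axioms(2)[OF J2]
  obtain xs where xs: "distinct xs" "set xs = pverts S"
    using finite_distinct_list[OF simple_graph.pair_finite_verts[OF J1S]] by blast
  obtain hs where hs: "distinct hs" "set hs = pverts H1"
    using finite_distinct_list[OF simple_graph.pair_finite_verts[OF J1H]] by blast
  obtain ks where ks: "distinct ks" "set ks = pverts H2"
    using finite_distinct_list[OF simple_graph.pair_finite_verts[OF J2H]] by blast
  define n where "n = length xs"
  define p where "p = length hs"
  have lk: "length ks = p"
    using assms(5) distinct_card[OF hs(1)] distinct_card[OF ks(1)] hs ks by (simp add: p_def)
  define M where "M = matrix_of xs (join_ecc_block X S)"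
  define U :: "complex mat" where "U = mat n p (\<lambda>(i, j). if xs ! i \<in> X then 0 else 2)"
  define V :: "complex mat" where "V = mat p n (\<lambda>(i, j). if xs ! j \<in> X then 0 else 2)"
  have M: "M \<in> carrier_mat n n" unfolding M_def n_def by (rule matrix_of_carrier)
  have U: "U \<in> carrier_mat n p" and V: "V \<in> carrier_mat p n"
    by (simp add: U_def, simp add: V_def)
  have V_index: "i < p \<Longrightarrow> j < n \<Longrightarrow> V $$ (i, j) = (if xs ! j \<in> X then 0 else 2)" for i j
    by (simp add: V_def)
  let ?D = "mat p p (\<lambda>_. 2) :: complex mat"
  let ?C1 = "- 2 \<cdot>\<^sub>m matrix_of hs (adjacency_entry H1) + - 2 \<cdot>\<^sub>m 1\<^sub>m p"
  let ?C2 = "- 2 \<cdot>\<^sub>m matrix_of ks (adjacency_entry H2) + - 2 \<cdot>\<^sub>m 1\<^sub>m p"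
  let ?c = "- 2 * of_nat k - 2 :: complex"
  have C: "?C1 \<in> carrier_mat p p" "?C2 \<in> carrier_mat p p"
    using matrix_of_carrier[of hs] matrix_of_carrier[of ks] by (auto simp: p_def lk)
  \<comment> \<open>Applied with \<open>W\<close> equal to \<open>V\<close> and to
    \<open>?D\<close>; that \<open>W $$ (i, j)\<close> depends on \<open>j\<close> alone means that
    each column is a multiple of the all-ones vector.\<close>
  have const_col: "(- 2 \<cdot>\<^sub>m A + - 2 \<cdot>\<^sub>m 1\<^sub>m p) * W = ?c \<cdot>\<^sub>m W"
    if A: "A \<in> carrier_mat p p" and W: "W \<in> carrier_mat p q"
      and rows: "\<And>i. i < p \<Longrightarrow> (\<Sum>j<p. A $$ (i, j)) = of_nat k"
      and cols: "\<And>i j. i < p \<Longrightarrow> j < q \<Longrightarrow> W $$ (i, j) = w j" for A W :: "complex mat" and q w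
  proof (rule eq_matI)
    fix i j assume "i < dim_row (?c \<cdot>\<^sub>m W)" "j < dim_col (?c \<cdot>\<^sub>m W)"
    then have ij: "i < p" "j < q" using W by auto
    have "((- 2 \<cdot>\<^sub>m A + - 2 \<cdot>\<^sub>m 1\<^sub>m p) * W) $$ (i, j) = (\<Sum>l<p. (- 2 * A $$ (i, l) - (if i = l then 2 else 0)) * w j)"
      using ij A W cols by (auto simp: scalar_prod_def lessThan_atLeast0 intro!: sum.cong)
    also have "\<dots> = (- 2 * (\<Sum>l<p. A $$ (i, l)) - (\<Sum>l<p. if i = l then 2 else 0)) * w j"
      by (simp only: sum_distrib_right[symmetric] sum_subtractf sum_distrib_left[symmetric])
    also have "\<dots> = (?c \<cdot>\<^sub>m W) $$ (i, j)"
      using ij W rows cols by simp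
    finally show "((- 2 \<cdot>\<^sub>m A + - 2 \<cdot>\<^sub>m 1\<^sub>m p) * W) $$ (i, j) = (?c \<cdot>\<^sub>m W) $$ (i, j)" .
  qed (use A W in auto)
  note rows1 = simple_graph.adjacency_row_sum[OF J1H assms(3) hs, folded p_def]
  note rows2 = simple_graph.adjacency_row_sum[OF J2H assms(4) ks, unfolded lk]
  have A: "matrix_of hs (adjacency_entry H1) \<in> carrier_mat p p" "matrix_of ks (adjacency_entry H2) \<in> carrier_mat p p"
    using matrix_of_carrier[of hs] matrix_of_carrier[of ks] by (auto simp: p_def lk)
  have D: "?D \<in> carrier_mat p p" and D_index: "i < p \<Longrightarrow> j < p \<Longrightarrow> ?D $$ (i, j) = 2" for i j
    by (rule mat_carrier, simp)
  have "char_poly (four_block_mat M U V (?C1 + ?D)) * char_poly ?C2 =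
      char_poly (four_block_mat M U V (?C2 + ?D)) * char_poly ?C1"
    by (rule char_poly_four_block_exchange[OF M U V D C
          const_col[OF A(1) V rows1 V_index] const_col[OF A(1) D rows1 D_index]
          const_col[OF A(2) V rows2 V_index] const_col[OF A(2) D rows2 D_index]])
  then have "proots (char_poly (four_block_mat M U V (?C1 + ?D)) * char_poly ?C2) =
      proots (char_poly (four_block_mat M U V (?C2 + ?D)) * char_poly ?C1)"
    by simp
  moreover have "char_poly (four_block_mat M U V (C + ?D)) \<noteq> 0" if "C \<in> carrier_mat p p" for C
    by (rule char_poly_neq_0[of _ "n + p"]) (use that M in auto)
  ultimately have "proots (char_poly (four_block_mat M U V (?C1 + ?D))) + proots (char_poly ?C2) =
      proots (char_poly (four_block_mat M U V (?C2 + ?D))) + proots (char_poly ?C1)"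
    using C char_poly_neq_0[OF C(1)] char_poly_neq_0[OF C(2)] by (simp only: proots_mult simp_thms)
  moreover have "ecc_spectrum (join_along X S H1) = proots (char_poly (four_block_mat M U V (?C1 + ?D)))"
  proof -
    have "distinct (map Inl xs @ map Inr hs)" "set (map Inl xs @ map Inr hs) = pverts (join_along X S H1)"
      using xs hs by (auto simp: distinct_map bipartite_join.verts_J[OF J1])
    then show ?thesis
      unfolding ecc_spectrum_def
      by (simp only: spectrum_on_eq bipartite_join.ecc_matrix_J[OF J1 xs hs] M_def U_def V_def n_def p_def)
  qed
  moreover have "ecc_spectrum (join_along X S H2) = proots (char_poly (four_block_mat M U V (?C2 + ?D)))"
  proof -
    have "distinct (map Inl xs @ map Inr ks)" "set (map Inl xs @ map Inr ks) = pverts (join_along X S H2)"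
      using xs ks by (auto simp: distinct_map bipartite_join.verts_J[OF J2])
    then show ?thesis
      unfolding ecc_spectrum_def
      by (simp only: spectrum_on_eq bipartite_join.ecc_matrix_J[OF J2 xs ks, unfolded lk] M_def U_def V_def n_def)
  qed
  moreover have "proots (char_poly ?C1) = image_mset (\<lambda>x. - 2 * x - 2) (adjacency_spectrum H1)"
    "proots (char_poly ?C2) = image_mset (\<lambda>x. - 2 * x - 2) (adjacency_spectrum H2)"
    unfolding adjacency_spectrum_def spectrum_on_eq[OF hs] spectrum_on_eq[OF ks]
    by (simp_all only: proots_char_poly_affine[OF A(1)] proots_char_poly_affine[OF A(2)] diff_conv_add_uminus)
  ultimately show ?thesis by (simp only:)
qed

section \<open>Spectra of joins with iterated line graphs\<close>

lemma (in bipartite_join) order_J: "order_of J = order_of S + order_of H"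
  using S.pair_finite_verts H.pair_finite_verts by (simp add: verts_J card_Plus)

text \<open>Equal \<epsilon>-spectra would cancel in \<open>join_spectrum_exchange\<close> and leave
  equal images of the adjacency spectra under an injective map.\<close>

lemma non_ecc_cospectral_join:
  assumes "bipartite_join S X H1" "bipartite_join S X H2"
    and "regular_graph H1 k" "regular_graph H2 k" "order_of H1 = order_of H2"
    and "adjacency_spectrum H1 \<noteq> adjacency_spectrum H2"
  shows "non_ecc_cospectral (join_along X S H1) (join_along X S H2)"
proof -
  note J1 = assms(1)
  note J2 = assms(2)
  have "inj (\<lambda>x :: complex. - 2 * x - 2)" by (auto intro: injI)
  then have "image_mset (\<lambda>x :: complex. - 2 * x - 2) A = image_mset (\<lambda>x. - 2 * x - 2) B \<longleftrightarrow> A = B" for A B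
    by (metis multiset.inj_map injD)
  then have "ecc_spectrum (join_along X S H1) \<noteq> ecc_spectrum (join_along X S H2)"
    using join_spectrum_exchange[OF assms(1-5)] assms(6) by auto
  then show ?thesis
    using digraph_iso_ecc_spectrum[OF _ bipartite_join.finite_verts_J[OF J1], of "join_along X S H2"] assms(5)
    by (auto simp: non_ecc_cospectral_def bipartite_join.order_J[OF J1] bipartite_join.order_J[OF J2])
qed

text \<open>The contribution of -2 A(H) - 2 I to the \<epsilon>-energy of a join; for regular
  \<open>H\<close> of fixed degree and order the rest of the energy is constant.\<close>

definition shifted_energy :: "'a pair_pre_digraph \<Rightarrow> real" where
  "shifted_energy H = (\<Sum>x\<in>#adjacency_spectrum H. cmod (- 2 * x - 2))"

lemma ecc_equienergetic_join:
  assumes "bipartite_join S X H1" "bipartite_join S X H2"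
    and "regular_graph H1 k" "regular_graph H2 k" "order_of H1 = order_of H2"
    and "shifted_energy H1 = shifted_energy H2"
  shows "ecc_equienergetic (join_along X S H1) (join_along X S H2)"
proof -
  note J1 = assms(1)
  note J2 = assms(2)
  have "(\<Sum>x\<in>#ecc_spectrum (join_along X S H1) + image_mset (\<lambda>x. - 2 * x - 2) (adjacency_spectrum H2). cmod x) =
      (\<Sum>x\<in>#ecc_spectrum (join_along X S H2) + image_mset (\<lambda>x. - 2 * x - 2) (adjacency_spectrum H1). cmod x)"
    by (simp only: join_spectrum_exchange[OF assms(1-5)])
  then have "ecc_energy (join_along X S H1) + shifted_energy H2 = ecc_energy (join_along X S H2) + shifted_energy H1"
    by (simp add: ecc_energy_def shifted_energy_def image_mset.compositionality o_def)
  then show ?thesis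
    using assms(5,6) by (simp add: ecc_equienergetic_def bipartite_join.order_J[OF J1] bipartite_join.order_J[OF J2])
qed

section \<open>Subdivision joins as joins along a colour class\<close>

context simple_graph
begin

lemma bipartite_vertex_join:
  assumes "\<forall>v\<in>pverts G. out_degree G v \<ge> 2" "pverts G \<noteq> {}" "pair_graph H" "pverts H \<noteq> {}"
  shows "bipartite_join (subdivision_graph G) (Inl ` pverts G) H"
proof -
  have Y: "pverts (subdivision_graph G) - Inl ` pverts G = Inr ` edges G"
    by (auto simp: subdivision_graph_def)
  show ?thesis
  proof (intro bipartite_join.intro bipartite_join_axioms.intro simple_graph.intro)
    show "Inl ` pverts G \<subseteq> pverts (subdivision_graph G)" by (auto simp: subdivision_graph_def)
    show "(a, b) \<in> parcs (subdivision_graph G) \<Longrightarrow> a \<in> Inl ` pverts G \<longleftrightarrow> b \<notin> Inl ` pverts G" for a b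
      using edge_subset_verts by (auto simp: subdivision_graph_def)
  next
    fix y :: "'a + 'a set" assume "y \<in> pverts (subdivision_graph G) - Inl ` pverts G"
    then obtain e where e: "y = Inr e" "e \<in> edges G" unfolding Y by blast
    then show "\<exists>x\<in>Inl ` pverts G. (y, x) \<in> parcs (subdivision_graph G)"
      by (auto simp: subdivision_arcs elim!: edgeE)
    show "\<exists>x\<in>Inl ` pverts G. (y, x) \<notin> parcs (subdivision_graph G)"
      using e non_incident_vertex[OF assms(1)] by (auto simp: subdivision_arcs)
  next
    fix x :: "'a + 'a set" assume "x \<in> Inl ` pverts G"
    then show "\<exists>y\<in>pverts (subdivision_graph G) - Inl ` pverts G. (x, y) \<notin> parcs (subdivision_graph G)"
      unfolding Y using non_incident_edge[OF assms(1)] by (auto simp: subdivision_arcs)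
  qed (use assms pair_graph_subdivision_graph in auto)
qed

text \<open>The colour classes trade places with those of the vertex join. \<open>neighbour\<close>
  and the nonemptiness of \<open>X\<close> now ask for an edge through a given vertex, which the
  degree condition provides.\<close>

lemma bipartite_edge_join:
  assumes "\<forall>v\<in>pverts G. out_degree G v \<ge> 2" "pverts G \<noteq> {}" "pair_graph H" "pverts H \<noteq> {}"
  shows "bipartite_join (subdivision_graph G) (Inr ` edges G) H"
proof -
  have Y: "pverts (subdivision_graph G) - Inr ` edges G = Inl ` pverts G"
    by (auto simp: subdivision_graph_def)
  have incident: "\<exists>e\<in>edges G. v \<in> e" if v: "v \<in> pverts G" for v
  proof -
    obtain w where "(v, w) \<in> parcs G" using other_neighbour assms(1) v by metis
    then show ?thesis by (intro bexI[of _ "{v, w}"]) (auto simp: edge_iff_arc)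
  qed
  show ?thesis
  proof (intro bipartite_join.intro bipartite_join_axioms.intro simple_graph.intro)
    show "Inr ` edges G \<subseteq> pverts (subdivision_graph G)" by (auto simp: subdivision_graph_def)
    show "(a, b) \<in> parcs (subdivision_graph G) \<Longrightarrow> a \<in> Inr ` edges G \<longleftrightarrow> b \<notin> Inr ` edges G" for a b
      by (auto simp: subdivision_graph_def)
  next
    fix y :: "'a + 'a set" assume "y \<in> pverts (subdivision_graph G) - Inr ` edges G"
    then obtain v where v: "y = Inl v" "v \<in> pverts G" unfolding Y by blast
    then show "\<exists>x\<in>Inr ` edges G. (y, x) \<in> parcs (subdivision_graph G)"
      using incident by (auto simp: subdivision_arcs)
    show "\<exists>x\<in>Inr ` edges G. (y, x) \<notin> parcs (subdivision_graph G)"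
      using v non_incident_edge[OF assms(1)] by (auto simp: subdivision_arcs)
  next
    fix x :: "'a + 'a set" assume "x \<in> Inr ` edges G"
    then show "\<exists>y\<in>pverts (subdivision_graph G) - Inr ` edges G. (x, y) \<notin> parcs (subdivision_graph G)"
      unfolding Y using non_incident_vertex[OF assms(1)] by (auto simp: subdivision_arcs)
  next
    show "Inr ` edges G \<noteq> {}" using incident assms(2) by auto
  qed (use assms pair_graph_subdivision_graph in auto)
qed

section \<open>Second line graphs of cubic graphs\<close>

text \<open>The line graph is 4-regular of order \<open>3 * t\<close>, with eigenvalues \<lambda> +
  1 and \<open>t\<close> times -2. The next step adds 2 to these and contributes another
  \<open>3 * t\<close> copies of -2.\<close>

lemma iterated_line_graph_of_cubic:
  assumes cubic: "regular_graph G 3" and order: "order_of G = 2 * t"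
  shows pair_graph_L2: "pair_graph (line_graph (line_graph G))"
    and regular_L2: "regular_graph (line_graph (line_graph G)) 6"
    and order_L2: "order_of (line_graph (line_graph G)) = 6 * t"
    and spectrum_L2: "adjacency_spectrum (line_graph (line_graph G)) =
      image_mset (\<lambda>x. x + 3) (adjacency_spectrum G) + replicate_mset t 0 + replicate_mset (3 * t) (- 2)"
proof -
  note L = simple_graph.intro[OF pair_graph_line_graph]
  show "pair_graph (line_graph (line_graph G))" by (rule simple_graph.pair_graph_line_graph[OF L])
  have regular_L: "regular_graph (line_graph G) 4"
    using regular_line_graph[OF cubic] by simp
  show "regular_graph (line_graph (line_graph G)) 6"
    using simple_graph.regular_line_graph[OF L regular_L] by simp
  \<comment> \<open>The edge numbers are kept as sums so that \<open>split\<close> exposes the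
    copies of -2 that cancel against the padding in \<open>line_graph_spectrum\<close>.\<close>
  have edges: "card (edges G) = t + 2 * t"
    using handshake[OF cubic] order by simp
  then have order_L: "order_of (line_graph G) = 3 * t"
    by (simp add: line_graph_def)
  have edges_L: "card (edges (line_graph G)) = 3 * t + 3 * t"
    using simple_graph.handshake[OF L regular_L] order_L by simp
  then show "order_of (line_graph (line_graph G)) = 6 * t"
    by (simp add: line_graph_def[of "line_graph G"])
  have split: "replicate_mset (m + n) x = replicate_mset m x + replicate_mset n x" for m n and x :: complex
    by (simp add: multiset_eq_iff)
  have shift: "(\<lambda>x :: complex. x + of_nat 3 - 2) = (\<lambda>x. x + 1)" "(\<lambda>x :: complex. x + of_nat 4 - 2) = (\<lambda>x. x + 2)"
    by (simp add: fun_eq_iff, simp add: fun_eq_iff)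
  have "adjacency_spectrum (line_graph G) + replicate_mset (2 * t) (- 2) =
      image_mset (\<lambda>x. x + 1) (adjacency_spectrum G) + replicate_mset (t + 2 * t) (- 2)"
    using line_graph_spectrum[OF cubic] by (simp only: shift edges order)
  then have spectrum_L: "adjacency_spectrum (line_graph G) =
      image_mset (\<lambda>x. x + 1) (adjacency_spectrum G) + replicate_mset t (- 2)"
    by (simp only: split flip: add.assoc) simp
  have "adjacency_spectrum (line_graph (line_graph G)) + replicate_mset (3 * t) (- 2) =
      image_mset (\<lambda>x. x + 2) (adjacency_spectrum (line_graph G)) + replicate_mset (3 * t + 3 * t) (- 2)"
    using simple_graph.line_graph_spectrum[OF L regular_L] by (simp only: shift edges_L order_L)
  then have "adjacency_spectrum (line_graph (line_graph G)) =
      image_mset (\<lambda>x. x + 2) (adjacency_spectrum (line_graph G)) + replicate_mset (3 * t) (- 2)"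
    by (simp only: split flip: add.assoc) simp
  then show "adjacency_spectrum (line_graph (line_graph G)) =
      image_mset (\<lambda>x. x + 3) (adjacency_spectrum G) + replicate_mset t 0 + replicate_mset (3 * t) (- 2)"
    by (simp add: spectrum_L image_mset.compositionality o_def add.assoc)
qed

text \<open>Since \<lambda> \<ge> -3, the term for \<lambda> + 3 is 8 + 2 \<lambda>; over
  \<open>2 * t\<close> eigenvalues with sum 0 these terms add up to \<open>16 * t\<close>. The
  eigenvalues 0 and -2 contribute 2 each, hence \<open>2 * t\<close> and
  \<open>6 * t\<close>.\<close>

lemma shifted_energy_L2:
  assumes cubic: "regular_graph G 3" and order: "order_of G = 2 * t"
  shows "shifted_energy (line_graph (line_graph G)) = 24 * real t"
proof -
  have cmod: "cmod (- 2 * (x + 3) - 2) = 8 + 2 * Re x" if x: "x \<in># adjacency_spectrum G" for x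
  proof -
    have "x = of_real (Re x)" and ge: "Re x \<ge> - 3"
      using adjacency_spectrum_bound[OF cubic x] by (simp, simp)
    then have "- 2 * (x + 3) - 2 = of_real (- (8 + 2 * Re x))" by (simp add: complex_eq_iff)
    then show ?thesis using ge by (simp only: norm_of_real)
  qed
  have sum: "(\<Sum>x\<in>#M. 8 + 2 * Re x) = 8 * real (size M) + 2 * Re (\<Sum>\<^sub># M)" for M
  proof (induction M)
    case empty
    show ?case by simp
  next
    case (add x M)
    then show ?case by simp
  qed
  have "(\<Sum>x\<in>#adjacency_spectrum G. cmod (- 2 * (x + 3) - 2)) = (\<Sum>x\<in>#adjacency_spectrum G. 8 + 2 * Re x)"
    by (rule arg_cong[of _ _ sum_mset], rule image_mset_cong, rule cmod)
  also have "\<dots> = 16 * real t"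
    by (simp add: sum size_adjacency_spectrum sum_adjacency_spectrum order)
  finally show ?thesis
    by (simp add: shifted_energy_def spectrum_L2[OF assms] image_mset.compositionality o_def sum_mset_replicate_mset)
qed

end

lemma shifted_energy_disjoint_union:
  assumes "finite (pverts G)" "finite (pverts H)"
  shows "shifted_energy (disjoint_union_graph G H) = shifted_energy G + shifted_energy H"
  by (simp add: shifted_energy_def adjacency_spectrum_disjoint_union[OF assms])

lemma order_disjoint_union:
  assumes "finite (pverts G)" "finite (pverts H)"
  shows "order_of (disjoint_union_graph G H) = order_of G + order_of H"
  using assms by (simp add: disjoint_union_graph_def card_Plus)

unused_thms

theorem theorem5p5:
  fixes t r :: nat
    and G1 :: "'a pair_pre_digraph" and G2 :: "'b pair_pre_digraph" and G :: "'c pair_pre_digraph"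
  assumes "t \<ge> 2"
    and "pair_graph G1" and "connected G1" and "regular_graph G1 3" and "order_of G1 = 2 * t"
    and "pair_graph G2" and "connected G2" and "regular_graph G2 3" and "order_of G2 = 2 * t"
    and "non_cospectral G1 G2"
    and "pair_graph G" and "connected G" and "regular_graph G r" and "r \<ge> 2"
  defines "H1 \<equiv> line_graph (line_graph G1)"
    and "H2 \<equiv> line_graph (line_graph G2)"
  defines "H12 \<equiv> disjoint_union_graph H1 H2"
    and "H11 \<equiv> disjoint_union_graph H1 H1"
    and "H22 \<equiv> disjoint_union_graph H2 H2"
  shows
    "(non_ecc_cospectral (subdivision_vertex_join G H1) (subdivision_vertex_join G H2) \<and>
      ecc_equienergetic (subdivision_vertex_join G H1) (subdivision_vertex_join G H2)) \<and>
     (non_ecc_cospectral (subdivision_edge_join G H1) (subdivision_edge_join G H2) \<and>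
      ecc_equienergetic (subdivision_edge_join G H1) (subdivision_edge_join G H2)) \<and>
     (non_ecc_cospectral (subdivision_vertex_join G H12) (subdivision_vertex_join G H11) \<and>
      non_ecc_cospectral (subdivision_vertex_join G H12) (subdivision_vertex_join G H22) \<and>
      non_ecc_cospectral (subdivision_vertex_join G H11) (subdivision_vertex_join G H22) \<and>
      ecc_equienergetic (subdivision_vertex_join G H12) (subdivision_vertex_join G H11) \<and>
      ecc_equienergetic (subdivision_vertex_join G H12) (subdivision_vertex_join G H22) \<and>
      ecc_equienergetic (subdivision_vertex_join G H11) (subdivision_vertex_join G H22)) \<and>
     (non_ecc_cospectral (subdivision_edge_join G H12) (subdivision_edge_join G H11) \<and>
      non_ecc_cospectral (subdivision_edge_join G H12) (subdivision_edge_join G H22) \<and>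
      non_ecc_cospectral (subdivision_edge_join G H11) (subdivision_edge_join G H22) \<and>
      ecc_equienergetic (subdivision_edge_join G H12) (subdivision_edge_join G H11) \<and>
      ecc_equienergetic (subdivision_edge_join G H12) (subdivision_edge_join G H22) \<and>
      ecc_equienergetic (subdivision_edge_join G H11) (subdivision_edge_join G H22))"
proof -
  have G1: "simple_graph G1" by (rule simple_graph.intro) fact
  have G2: "simple_graph G2" by (rule simple_graph.intro) fact
  have G: "simple_graph G" by (rule simple_graph.intro) fact
  have H1: "simple_graph H1"
    unfolding H1_def by (rule simple_graph.intro[OF simple_graph.pair_graph_L2[OF G1 assms(4,5)]])
  have H2: "simple_graph H2"
    unfolding H2_def by (rule simple_graph.intro[OF simple_graph.pair_graph_L2[OF G2 assms(8,9)]])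
  have reg: "regular_graph H1 6" "regular_graph H2 6"
    unfolding H1_def H2_def
    using simple_graph.regular_L2[OF G1 assms(4,5)] simple_graph.regular_L2[OF G2 assms(8,9)] .
  have order: "order_of H1 = 6 * t" "order_of H2 = 6 * t"
    unfolding H1_def H2_def
    using simple_graph.order_L2[OF G1 assms(4,5)] simple_graph.order_L2[OF G2 assms(8,9)] .
  have energy: "shifted_energy H1 = 24 * real t" "shifted_energy H2 = 24 * real t"
    unfolding H1_def H2_def
    using simple_graph.shifted_energy_L2[OF G1 assms(4,5)] simple_graph.shifted_energy_L2[OF G2 assms(8,9)] .
  \<comment> \<open>The eigenvalues 0 and -2 from \<open>spectrum_L2\<close> have the same
    multiplicities for both graphs and cancel; injectivity of the shift then recovers the spectra of
    \<open>G1\<close> and \<open>G2\<close>.\<close>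
  have "inj (\<lambda>x :: complex. x + 3)" by (auto intro: injI)
  then have "image_mset (\<lambda>x :: complex. x + 3) A = image_mset (\<lambda>x. x + 3) B \<longleftrightarrow> A = B" for A B
    by (metis multiset.inj_map injD)
  then have spec: "adjacency_spectrum H1 \<noteq> adjacency_spectrum H2"
    using assms(10) unfolding H1_def H2_def
    by (simp add: simple_graph.spectrum_L2[OF G1 assms(4,5)] simple_graph.spectrum_L2[OF G2 assms(8,9)] non_cospectral_def)
  note fin = simple_graph.pair_finite_verts[OF H1] simple_graph.pair_finite_verts[OF H2]
  have U: "pair_graph H12" "pair_graph H11" "pair_graph H22"
    unfolding H12_def H11_def H22_def by (intro pair_graph_disjoint_union simple_graph.pair_graph[OF H1] simple_graph.pair_graph[OF H2])+
  have regU: "regular_graph H12 6" "regular_graph H11 6" "regular_graph H22 6"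
    unfolding H12_def H11_def H22_def
    by (intro regular_disjoint_union simple_graph.pair_graph[OF H1] simple_graph.pair_graph[OF H2] reg)+
  have orderU: "order_of H12 = 12 * t" "order_of H11 = 12 * t" "order_of H22 = 12 * t"
    unfolding H12_def H11_def H22_def by (simp_all add: order_disjoint_union fin order)
  have energyU: "shifted_energy H12 = 48 * real t" "shifted_energy H11 = 48 * real t"
    "shifted_energy H22 = 48 * real t"
    unfolding H12_def H11_def H22_def by (simp_all add: shifted_energy_disjoint_union fin energy)
  \<comment> \<open>Needed for \<open>H11\<close> against \<open>H22\<close>, whose spectra are
    doubled; against \<open>H12\<close> a common summand cancels instead.\<close>
  have double: "A + A = B + B \<longleftrightarrow> A = B" for A B :: "complex multiset"
  proof
    assume "A + A = B + B"
    then have "count A x + count A x = count B x + count B x" for x by (metis count_union)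
    then have "count A x = count B x" for x by (metis mult_2 nat_mult_eq_cancel1 zero_less_numeral)
    then show "A = B" by (rule multiset_eqI)
  qed simp
  have specU: "adjacency_spectrum H12 \<noteq> adjacency_spectrum H11" "adjacency_spectrum H12 \<noteq> adjacency_spectrum H22"
    "adjacency_spectrum H11 \<noteq> adjacency_spectrum H22"
    unfolding H12_def H11_def H22_def
    using spec by (auto simp: adjacency_spectrum_disjoint_union fin double)
  have deg: "\<forall>v\<in>pverts G. out_degree G v \<ge> 2"
    using assms(13,14) by (simp add: regular_graph_def)
  \<comment> \<open>Strong connectedness, by which \<open>connected\<close> is defined, includes a
    nonempty vertex set.\<close>
  have "pverts G \<noteq> {}"
    using assms(12) by (auto simp: connected_def strongly_connected_def)
  note V = simple_graph.bipartite_vertex_join[OF G deg this] and E = simple_graph.bipartite_edge_join[OF G deg this]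
  have nonempty: "pverts H1 \<noteq> {}" "pverts H2 \<noteq> {}" "pverts H12 \<noteq> {}" "pverts H11 \<noteq> {}" "pverts H22 \<noteq> {}"
    using order orderU assms(1) by auto
  note bip = V[OF simple_graph.pair_graph[OF H1] nonempty(1)] V[OF simple_graph.pair_graph[OF H2] nonempty(2)]
    E[OF simple_graph.pair_graph[OF H1] nonempty(1)] E[OF simple_graph.pair_graph[OF H2] nonempty(2)]
    V[OF U(1) nonempty(3)] V[OF U(2) nonempty(4)] V[OF U(3) nonempty(5)]
    E[OF U(1) nonempty(3)] E[OF U(2) nonempty(4)] E[OF U(3) nonempty(5)]
  show ?thesis
    unfolding subdivision_vertex_join_def subdivision_edge_join_def
    by (intro conjI non_ecc_cospectral_join[where k = 6] ecc_equienergetic_join[where k = 6]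
        bip reg regU spec specU; simp add: order orderU energy energyU)
qed

end
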